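(* Let $P\subset\mathbb{R}^m$ with $\bar p\in P$, and consider the split system $g(p,x)=(g_1(p,x),g_2(p,x))\in C_1\times C_2=C$, $g_i$ with values in $\mathbb{R}^{l_i}$, $C_i\subset\mathbb{R}^{l_i}$ closed, $l_1+l_2=l$, where $g$ is defined on a neighborhood of $(\bar p,\bar x)$ in $\mathbb{R}^m\times\mathbb{R}^n$, is twice differentiable at $(\bar p,\bar x)\in\operatorname{gph}\Gamma$, and satisfies the standing assumptions. Suppose: (a) for every $w\in T_P(\bar p)$ and every sequence $\tau_k\downarrow0$ there is $u\in\mathbb{R}^n$ with $\liminf_{k\to\infty}\operatorname{dist}(g(\bar p,\bar x)+\tau_k\nabla g(\bar p,\bar x)(w,u);C)/\tau_k=0$; (b) Robinson stability holds at $(\bar p,\bar x)$ for the subsystem $g_2(p,x)\in C_2$, $p\in P$; (c) for every triple $(w,u,\lambda)\in\mathbb{R}^m\times\mathbb{R}^n\times\mathbb{R}^l$ satisfying $(w,u)\ne(0,0)$, $w\in T_P(\bar p)$, $\nabla g(\bar p,\bar x)(w,u)\in T_C(g(\bar p,\bar x))$, $\lambda\in N_C(g(\bar p,\bar x);\nabla g(\bar p,\bar x)(w,u))$, $\nabla_xg(\bar p,\bar x)^T\lambda=0$, and $\tfrac12\langle\nabla^2\langle\lambda,g\rangle(\bar p,\bar x)(w,u),(w,u)\rangle+\overline\chi_P(\nabla_pg(\bar p,\bar x)^T\lambda,\bar p;w)\ge\underline\chi_C(\lambda,g(\bar p,\bar x);\nabla g(\bar p,\bar x)(w,u))$, one has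 $\lambda^1=0$, where $\lambda=(\lambda^1,\lambda^2)\in\mathbb{R}^{l_1}\times\mathbb{R}^{l_2}$. Then Robinson stability holds at $(\bar p,\bar x)$ for the whole system $g(p,x)\in C$, $p\in P$.
   Context: $\Gamma(p)=\{x:g(p,x)\in C\}$ for $p\in P$. Standing assumptions: there are neighborhoods $U$ of $\bar x$ and $V$ of $\bar p$ (relative to $P$) such that for each $p\in V$ the map $g(p,\cdot)$ is continuously differentiable on $U$, and $g$, $\nabla_xg$ are continuous at $(\bar p,\bar x)$. $\nabla g(\bar p,\bar x)(w,u)=\nabla_pg(\bar p,\bar x)w+\nabla_xg(\bar p,\bar x)u$; $\langle\lambda,g\rangle(p,x)=\langle\lambda,g(p,x)\rangle$. Robinson stability of a system $h(p,x)\in K$, $p\in P$, at $(\bar p,\bar x)$: there exist $\kappa\ge0$ and neighborhoods $U$ of $\bar x$, $V$ of $\bar p$ in $P$ with $\operatorname{dist}(x;\{\xi:h(p,\xi)\in K\})\le\kappa\operatorname{dist}(h(p,x);K)$ for all $(p,x)\in V\times U$. Upper curvature $\overline\chi_\Omega(\lambda,\bar z;v):=\lim_{\epsilon\downarrow0}\sup\{\langle\lambda,v'-v\rangle/\tau: 0<\tau<\epsilon,\|v'-v\|<\epsilon,\bar z+\tau v'\in\Omega\}$; lower curvature $\underline\chi_\Omega(\lambda,\bar z;v):=\lim_{\epsilon\downarrow0}\inf\{\langle\lambda,v'-v\rangle/\tau: 0<\tau<\epsilon,\|v'-v\|<\epsilon,\operatorname{dist}(\lambda;N_\Omega(\bar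 z+\tau v'))<\epsilon\}$ ($\sup\emptyset=-\infty$, $\inf\emptyset=+\infty$, $N_\Omega(z)=\emptyset$ off $\Omega$). $T$ is the contingent cone, $N$ the limiting normal cone, and $N_\Omega(\bar z;w)=\{v:\exists t_k\downarrow0,w_k\to w,v_k\to v,\ \bar z+t_kw_k\in\Omega,\ v_k\in\widehat N_\Omega(\bar z+t_kw_k)\}$ the directional limiting normal cone ($\widehat N$ regular normal cone). *)

theory Defs
  imports "HOL-Analysis.Analysis"
begin

definition tangent_cone :: "'a::real_normed_vector set \<Rightarrow> 'a \<Rightarrow> 'a set" where
  "tangent_cone \<Omega> z = {w. \<exists>t ww. (\<forall>k. t k > 0) \<and> t \<longlonglongrightarrow> 0 \<and> ww \<longlonglongrightarrow> w \<and>
       (\<forall>k. z + t k *\<^sub>R ww k \<in> \<Omega>)}"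

definition regular_normal_cone :: "'a::real_inner set \<Rightarrow> 'a \<Rightarrow> 'a set" where
  "regular_normal_cone \<Omega> z = (if z \<in> \<Omega> then
     {v. \<forall>\<epsilon>>0. \<exists>\<delta>>0. \<forall>z'\<in>\<Omega>. dist z' z < \<delta> \<longrightarrow> inner v (z' - z) \<le> \<epsilon> * norm (z' - z)}
   else {})"

definition limiting_normal_cone :: "'a::real_inner set \<Rightarrow> 'a \<Rightarrow> 'a set" where
  "limiting_normal_cone \<Omega> z = (if z \<in> \<Omega> then
     {v. \<exists>zz vv. (\<forall>k. zz k \<in> \<Omega> \<and> vv k \<in> regular_normal_cone \<Omega> (zz k)) \<and>
          zz \<longlonglongrightarrow> z \<and> vv \<longlonglongrightarrow> v}
   else {})"

definition dir_limiting_normal_cone :: "'a::real_inner set \<Rightarrow> 'a \<Rightarrow> 'a \<Rightarrow> 'a set" where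
  "dir_limiting_normal_cone \<Omega> z w =
     {v. \<exists>t ww vv. (\<forall>k. t k > 0) \<and> t \<longlonglongrightarrow> 0 \<and> ww \<longlonglongrightarrow> w \<and> vv \<longlonglongrightarrow> v \<and>
          (\<forall>k. z + t k *\<^sub>R ww k \<in> \<Omega> \<and> vv k \<in> regular_normal_cone \<Omega> (z + t k *\<^sub>R ww k))}"

text \<open>Upper curvature (extended-real valued; \<open>Sup {} = -\<infinity>\<close>).\<close>
definition upper_curvature :: "'a::real_inner set \<Rightarrow> 'a \<Rightarrow> 'a \<Rightarrow> 'a \<Rightarrow> ereal" where
  "upper_curvature \<Omega> lam z v = Lim (at_right (0::real)) (\<lambda>\<epsilon>.
     Sup {ereal (inner lam (v' - v) / \<tau>) | \<tau> v'.
            0 < \<tau> \<and> \<tau> < \<epsilon> \<and> norm (v' - v) < \<epsilon> \<and> z + \<tau> *\<^sub>R v' \<in> \<Omega>})"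

text \<open>Lower curvature (extended-real valued; \<open>Inf {} = +\<infinity>\<close>).
  The condition \<open>dist(\<lambda>; N(z+\<tau>v')) < \<epsilon>\<close> is written out as the existence of a normal
  within distance \<open>\<epsilon>\<close> (so it fails when the normal cone is empty, i.e. distance \<open>+\<infinity>\<close>).\<close>
definition lower_curvature :: "'a::real_inner set \<Rightarrow> 'a \<Rightarrow> 'a \<Rightarrow> 'a \<Rightarrow> ereal" where
  "lower_curvature \<Omega> lam z v = Lim (at_right (0::real)) (\<lambda>\<epsilon>.
     Inf {ereal (inner lam (v' - v) / \<tau>) | \<tau> v'.
            0 < \<tau> \<and> \<tau> < \<epsilon> \<and> norm (v' - v) < \<epsilon> \<and>
            (\<exists>\<mu>\<in>limiting_normal_cone \<Omega> (z + \<tau> *\<^sub>R v'). dist lam \<mu> < \<epsilon>)})"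

text \<open>Robinson stability of the system \<open>h(p,x) \<in> K, p \<in> P\<close> at \<open>(pb,xb)\<close>.
  \<open>dist(x; \<emptyset>) = +\<infinity>\<close> in the paper, so the inequality forces the feasible set to be nonempty
  (for nonempty \<open>K\<close>); this is made explicit since \<open>infdist x {} = 0\<close> in Isabelle.\<close>
definition robinson_stable ::
  "'p::real_normed_vector set \<Rightarrow> ('p \<Rightarrow> 'x::real_normed_vector \<Rightarrow> 'k::real_normed_vector) \<Rightarrow> 'k set \<Rightarrow> 'p \<Rightarrow> 'x \<Rightarrow> bool" where
  "robinson_stable P h K pb xb \<longleftrightarrow>
     (\<exists>\<kappa>\<ge>0. \<exists>U V. open U \<and> xb \<in> U \<and> open V \<and> pb \<in> V \<and>
        (\<forall>p\<in>P \<inter> V. \<forall>x\<in>U. {\<xi>. h p \<xi> \<in> K} \<noteq> {} \<and>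
            infdist x {\<xi>. h p \<xi> \<in> K} \<le> \<kappa> * infdist (h p x) K))"

end

theory Submission
  imports Defs
begin

text \<open>
  If Robinson stability of the whole system fails, there are \<open>p\<^sub>k \<rightarrow> pb\<close> and infeasible \<open>x\<^sub>k \<rightarrow> xb\<close> with
  residual \<open>d\<^sub>k\<close> much smaller than the distance \<open>r\<^sub>k\<close> from \<open>x\<^sub>k\<close> to the solution set. Near \<open>x\<^sub>k\<close> one minimises
  \<open>dist(g\<^sub>1; C\<^sub>1) + (\<rho>/2) dist(g\<^sub>2; C\<^sub>2)\<^sup>2 + |x - x\<^sub>k|\<^sup>2 / r\<^sub>k\<close>. For large \<open>\<rho>\<close> the minimiser has a nonzero
  residual in \<open>C\<^sub>1\<close>, so the penalty is smooth there once the projections are frozen, and this yields approximate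
  multipliers with unit first component; Robinson stability of the second subsystem keeps the second
  component bounded. A limit of the multipliers along a direction \<open>(w, u)\<close> violates (c): since they point from
  the projections to the values of \<open>g\<close>, the second-order expansion of \<open>g\<close> gives the curvature inequality.
  This argument needs \<open>r\<^sub>k = O(|(p\<^sub>k - pb, x\<^sub>k - xb)|)\<close>. When \<open>p\<^sub>k = pb\<close> that is clear, as \<open>xb\<close> is a solution;
  otherwise the same argument is first run at the points \<open>xb + |p\<^sub>k - pb| u\<close> provided by (a).
\<close>

section \<open>The curvatures as one-sided limits in the extended reals\<close>

text \<open>The set under the supremum shrinks with \<open>\<epsilon>\<close>, so the supremum is
  monotone and its limit from the right exists as an infimum. Hence \<open>Lim\<close> in the
  definition is a genuine limit and not an arbitrary value.\<close>

lemma upper_curvature_tendsto: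
  "((\<lambda>\<epsilon>. Sup {ereal (inner lam (v' - v) / \<tau>) | \<tau> v'.
       0 < \<tau> \<and> \<tau> < \<epsilon> \<and> norm (v' - v) < \<epsilon> \<and> z + \<tau> *\<^sub>R v' \<in> \<Omega>})
     \<longlongrightarrow> upper_curvature \<Omega> lam z v) (at_right 0)" (is "(?f \<longlongrightarrow> _) _")
proof -
  have mono: "?f a \<le> ?f b" if "a \<le> b" for a b
    by (intro Sup_subset_mono Collect_mono impI; elim exE conjE; intro exI conjI;
        (assumption | (rule less_le_trans[OF _ that], assumption)))
  have "(?f \<longlongrightarrow> Inf (?f ` ({0<..} \<inter> UNIV))) (at 0 within ({0<..} \<inter> UNIV))"
    by (rule Lim_right_bound[where K = "-\<infinity>"]) (use mono in auto)
  then have "(?f \<longlongrightarrow> Inf (?f ` {0<..})) (at_right 0)" by simp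
  moreover from this have "upper_curvature \<Omega> lam z v = Inf (?f ` {0<..})"
    unfolding upper_curvature_def by (intro tendsto_Lim) auto
  ultimately show ?thesis by simp
qed

text \<open>Here the infimum grows as \<open>\<epsilon>\<close> decreases; negation leads back to
  the monotone situation of the upper curvature.\<close>

lemma lower_curvature_tendsto:
  "((\<lambda>\<epsilon>. Inf {ereal (inner lam (v' - v) / \<tau>) | \<tau> v'.
       0 < \<tau> \<and> \<tau> < \<epsilon> \<and> norm (v' - v) < \<epsilon> \<and>
       (\<exists>\<mu>\<in>limiting_normal_cone \<Omega> (z + \<tau> *\<^sub>R v'). dist lam \<mu> < \<epsilon>)})
     \<longlongrightarrow> lower_curvature \<Omega> lam z v) (at_right 0)" (is "(?f \<longlongrightarrow> _) _")
proof -
  have mono: "?f b \<le> ?f a" if "a \<le> b" for a b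
    by (intro Inf_superset_mono Collect_mono impI; elim exE conjE bexE; intro exI conjI bexI;
        (assumption | (rule less_le_trans[OF _ that], assumption)))
  have "((\<lambda>\<epsilon>. - ?f \<epsilon>) \<longlongrightarrow> Inf ((\<lambda>\<epsilon>. - ?f \<epsilon>) ` ({0<..} \<inter> UNIV))) (at 0 within ({0<..} \<inter> UNIV))"
    by (rule Lim_right_bound[where K = "-\<infinity>"]) (use mono in \<open>simp_all only: ereal_minus_le_minus ereal_less_eq\<close>)
  then have "((\<lambda>\<epsilon>. - (- ?f \<epsilon>)) \<longlongrightarrow> - Inf ((\<lambda>\<epsilon>. - ?f \<epsilon>) ` {0<..})) (at_right 0)"
    by (intro tendsto_uminus_ereal) simp
  then have "(?f \<longlongrightarrow> - Inf ((\<lambda>\<epsilon>. - ?f \<epsilon>) ` {0<..})) (at_right 0)"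
    by simp
  moreover from this have "lower_curvature \<Omega> lam z v = - Inf ((\<lambda>\<epsilon>. - ?f \<epsilon>) ` {0<..})"
    unfolding lower_curvature_def by (intro tendsto_Lim) auto
  ultimately show ?thesis by simp
qed

section \<open>Regular normals: nearest points and products\<close>

lemma regular_normal_coneD:
  assumes "v \<in> regular_normal_cone \<Omega> z" "\<epsilon> > 0"
  shows "\<exists>\<delta>>0. \<forall>z'\<in>\<Omega>. dist z' z < \<delta> \<longrightarrow> inner v (z' - z) \<le> \<epsilon> * norm (z' - z)"
  using assms by (simp add: regular_normal_cone_def split: if_splits)

lemma regular_imp_limiting_normal:
  assumes "v \<in> regular_normal_cone \<Omega> z"
  shows "v \<in> limiting_normal_cone \<Omega> z"
proof -
  have "z \<in> \<Omega>" using assms by (auto simp: regular_normal_cone_def split: if_splits)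
  then show ?thesis
    using assms unfolding limiting_normal_cone_def
    by (simp, intro exI[of _ "\<lambda>_. z"] conjI exI[of _ "\<lambda>_. v"]) simp_all
qed

text \<open>Expanding the square in the nearest-point inequality bounds
  \<open>inner (a - y) (y' - y)\<close> by half of the squared distance, which is of smaller order
  than the distance and stays so after scaling by \<open>c\<close>.\<close>

lemma scaled_proximal_regular_normal:
  fixes a y :: "'a::real_inner"
  assumes y: "y \<in> C" and near: "\<And>y'. y' \<in> C \<Longrightarrow> dist a y \<le> dist a y'" and c: "0 \<le> c"
  shows "c *\<^sub>R (a - y) \<in> regular_normal_cone C y"
proof -
  have prox: "inner (a - y) (y' - y) \<le> (norm (y' - y))\<^sup>2 / 2" if "y' \<in> C" for y'
  proof -
    have "(norm (a - y))\<^sup>2 \<le> (norm (a - y'))\<^sup>2"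
      using near[OF that] by (simp add: dist_norm)
    moreover have "(norm (a - y'))\<^sup>2 = (norm (a - y))\<^sup>2 - 2 * inner (a - y) (y' - y) + (norm (y' - y))\<^sup>2"
      by (simp add: power2_norm_eq_inner algebra_simps inner_commute)
    ultimately show ?thesis by simp
  qed
  have "\<exists>\<delta>>0. \<forall>z'\<in>C. dist z' y < \<delta> \<longrightarrow> inner (c *\<^sub>R (a - y)) (z' - y) \<le> \<epsilon> * norm (z' - y)"
    if "\<epsilon> > 0" for \<epsilon>
  \<comment> \<open>This radius gives \<open>c * norm (z' - y) \<le> 2 * \<epsilon>\<close>; the
    denominator \<open>c + 1\<close> covers \<open>c = 0\<close>.\<close>
  proof (intro exI[of _ "2 * \<epsilon> / (c + 1)"] conjI ballI impI)
    show "2 * \<epsilon> / (c + 1) > 0" using c that by simp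
    fix z' assume z': "z' \<in> C" "dist z' y < 2 * \<epsilon> / (c + 1)"
    then have "(c + 1) * norm (z' - y) \<le> 2 * \<epsilon>"
      using c by (simp add: dist_norm field_simps)
    then have "c * norm (z' - y) \<le> 2 * \<epsilon>"
      by (smt (verit) mult_right_mono norm_ge_zero)
    then have "c * norm (z' - y) * norm (z' - y) \<le> 2 * \<epsilon> * norm (z' - y)"
      by (rule mult_right_mono) simp
    then have "c * ((norm (z' - y))\<^sup>2 / 2) \<le> \<epsilon> * norm (z' - y)"
      by (simp add: power2_eq_square)
    moreover have "inner (c *\<^sub>R (a - y)) (z' - y) \<le> c * ((norm (z' - y))\<^sup>2 / 2)"
      using mult_left_mono[OF prox[OF z'(1)] c] by simp
    ultimately show "inner (c *\<^sub>R (a - y)) (z' - y) \<le> \<epsilon> * norm (z' - y)" by linarith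
  qed
  then show ?thesis using y by (simp add: regular_normal_cone_def)
qed

text \<open>Each block receives half of \<open>\<epsilon>\<close>, and the norm of a block is at
  most the norm of the pair.\<close>

lemma regular_normal_cone_Times:
  fixes C1 :: "'a::real_inner set" and C2 :: "'b::real_inner set"
  assumes l1: "l1 \<in> regular_normal_cone C1 y1" and l2: "l2 \<in> regular_normal_cone C2 y2"
  shows "(l1, l2) \<in> regular_normal_cone (C1 \<times> C2) (y1, y2)"
proof -
  have y: "y1 \<in> C1" "y2 \<in> C2"
    using assms by (auto simp: regular_normal_cone_def split: if_splits)
  have "\<exists>\<delta>>0. \<forall>z'\<in>C1 \<times> C2. dist z' (y1, y2) < \<delta> \<longrightarrow>
      inner (l1, l2) (z' - (y1, y2)) \<le> \<epsilon> * norm (z' - (y1, y2))" if "\<epsilon> > 0" for \<epsilon>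
  proof -
    have e: "\<epsilon> / 2 > 0" using that by simp
    obtain d1 where d1: "d1 > 0"
      "\<And>z'. z' \<in> C1 \<Longrightarrow> dist z' y1 < d1 \<Longrightarrow> inner l1 (z' - y1) \<le> \<epsilon> / 2 * norm (z' - y1)"
      using regular_normal_coneD[OF l1 e] by blast
    obtain d2 where d2: "d2 > 0"
      "\<And>z'. z' \<in> C2 \<Longrightarrow> dist z' y2 < d2 \<Longrightarrow> inner l2 (z' - y2) \<le> \<epsilon> / 2 * norm (z' - y2)"
      using regular_normal_coneD[OF l2 e] by blast
    show ?thesis
    proof (intro exI[of _ "min d1 d2"] conjI ballI impI)
      show "min d1 d2 > 0" using d1 d2 by simp
      fix z' assume z': "z' \<in> C1 \<times> C2" "dist z' (y1, y2) < min d1 d2"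
      obtain a b where ab: "z' = (a, b)" "a \<in> C1" "b \<in> C2" using z' by auto
      have na: "norm (a - y1) \<le> norm (z' - (y1, y2))" and nb: "norm (b - y2) \<le> norm (z' - (y1, y2))"
        using norm_fst_le[of "a - y1" "b - y2"] norm_snd_le[of "b - y2" "a - y1"] ab by auto
      have "inner l1 (a - y1) \<le> \<epsilon> / 2 * norm (a - y1)" "inner l2 (b - y2) \<le> \<epsilon> / 2 * norm (b - y2)"
        using d1 d2 na nb z' ab by (auto simp: dist_norm)
      moreover have "\<epsilon> / 2 * norm (a - y1) \<le> \<epsilon> / 2 * norm (z' - (y1, y2))"
        "\<epsilon> / 2 * norm (b - y2) \<le> \<epsilon> / 2 * norm (z' - (y1, y2))"
        using na nb e by (auto intro!: mult_left_mono)
      ultimately show "inner (l1, l2) (z' - (y1, y2)) \<le> \<epsilon> * norm (z' - (y1, y2))"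
        by (simp add: ab(1))
    qed
  qed
  then show ?thesis using y by (simp add: regular_normal_cone_def)
qed

section \<open>Second-order expansion at a point\<close>

text \<open>\<open>G\<close> is differentiable only at \<open>z\<close>, so no second derivative is
  at hand nearby. The mean value inequality is instead applied along the segment to \<open>g\<close>
  minus its quadratic model, which uses only the first-order expansion of \<open>G\<close> at
  \<open>z\<close>.\<close>

lemma second_order_expansion:
  fixes g :: "'z::real_normed_vector \<Rightarrow> 'y::real_normed_vector" and G G2 :: "'z \<Rightarrow> 'z \<Rightarrow>\<^sub>L 'y"
  assumes S: "open S" "z \<in> S" and der: "\<And>z. z \<in> S \<Longrightarrow> (g has_derivative blinfun_apply (G z)) (at z)"
    and G2: "(G has_derivative G2) (at z)" and e: "\<epsilon> > 0"
  shows "\<exists>\<delta>>0. \<forall>h. norm h < \<delta> \<longrightarrow>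
    norm (g (z + h) - g z - G z h - (1/2) *\<^sub>R G2 h h) \<le> \<epsilon> * (norm h)\<^sup>2"
proof -
  obtain d1 where d1: "d1 > 0" "ball z d1 \<subseteq> S" using S openE by blast
  obtain d2 where d2: "d2 > 0"
    "\<And>y. norm (y - z) < d2 \<Longrightarrow> norm (G y - G z - G2 (y - z)) \<le> \<epsilon> * norm (y - z)"
    using G2 e unfolding has_derivative_at_alt by blast
  interpret G2: bounded_linear G2 by (rule has_derivative_bounded_linear[OF G2])
  show ?thesis
  proof (intro exI[of _ "min d1 d2"] conjI allI impI)
    show "min d1 d2 > 0" using d1 d2 by simp
    fix h :: 'z assume h: "norm h < min d1 d2"
    \<comment> \<open>\<open>\<phi> 1 - \<phi> 0\<close> is exactly the remainder to be estimated,
      and \<open>\<phi>' s\<close> is small because it is the linearisation error of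
      \<open>G\<close> at \<open>z\<close>, evaluated on \<open>h\<close>.\<close>
    define \<phi> where "\<phi> s = g (z + s *\<^sub>R h) - s *\<^sub>R G z h - (s\<^sup>2/2) *\<^sub>R G2 h h" for s :: real
    define \<phi>' where "\<phi>' s t = t *\<^sub>R (G (z + s *\<^sub>R h) h - G z h - s *\<^sub>R G2 h h)" for s t :: real
    have small: "norm (s *\<^sub>R h) < min d1 d2" if "s \<in> {0..1}" for s
      using that h mult_left_le_one_le[of "norm h" "\<bar>s\<bar>"] by simp
    have "norm (\<phi> 1 - \<phi> 0) \<le> (\<epsilon> * (norm h)\<^sup>2) * norm (1 - 0 :: real)"
    proof (rule differentiable_bound[of "{0..1}" \<phi> \<phi>'])
      fix s :: real assume s: "s \<in> {0..1}"
      have "z + s *\<^sub>R h \<in> ball z d1" using small[OF s] by (simp add: dist_norm)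
      then have "(g has_derivative blinfun_apply (G (z + s *\<^sub>R h))) (at (z + s *\<^sub>R h))"
        using d1 der by blast
      then have "((\<lambda>s. g (z + s *\<^sub>R h)) has_derivative (\<lambda>t. G (z + s *\<^sub>R h) (t *\<^sub>R h))) (at s within {0..1})"
        by (rule has_derivative_compose[rotated]) (auto intro!: derivative_eq_intros)
      then show "(\<phi> has_derivative \<phi>' s) (at s within {0..1})"
        unfolding \<phi>_def \<phi>'_def
        by (auto intro!: derivative_eq_intros simp: blinfun.scaleR_right algebra_simps)
      have "norm ((G (z + s *\<^sub>R h) - G z - G2 (s *\<^sub>R h)) h) \<le> \<epsilon> * norm (s *\<^sub>R h) * norm h"
        using d2(2)[of "z + s *\<^sub>R h"] small[OF s]
        by (intro order_trans[OF norm_blinfun] mult_right_mono) auto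
      also have "\<dots> \<le> \<epsilon> * (norm h)\<^sup>2"
        using s e mult_right_mono[of s 1 "norm h * norm h"]
        by (simp add: power2_eq_square mult.assoc)
      finally have *: "norm (G (z + s *\<^sub>R h) h - G z h - s *\<^sub>R G2 h h) \<le> \<epsilon> * (norm h)\<^sup>2"
        by (simp add: blinfun.diff_left G2.scaleR blinfun.scaleR_left)
      show "onorm (\<phi>' s) \<le> \<epsilon> * (norm h)\<^sup>2"
        unfolding \<phi>'_def
        using mult_left_mono[OF *] by (intro onorm_le) (simp add: mult.commute)
    qed auto
    then show "norm (g (z + h) - g z - G z h - (1/2) *\<^sub>R G2 h h) \<le> \<epsilon> * (norm h)\<^sup>2"
      by (simp add: \<phi>_def algebra_simps)
  qed
qed

lemma second_order_quotient_tendsto: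
  fixes g :: "'z::real_normed_vector \<Rightarrow> 'y::real_normed_vector" and G G2 :: "'z \<Rightarrow> 'z \<Rightarrow>\<^sub>L 'y"
  assumes S: "open S" "z \<in> S" and der: "\<And>z. z \<in> S \<Longrightarrow> (g has_derivative blinfun_apply (G z)) (at z)"
    and G2: "(G has_derivative G2) (at z)"
    and t: "\<And>k::nat. t k > 0" "t \<longlonglongrightarrow> 0" and h: "h \<longlonglongrightarrow> h0"
  shows "(\<lambda>k. (1 / (t k)\<^sup>2) *\<^sub>R (g (z + t k *\<^sub>R h k) - g z - t k *\<^sub>R G z (h k)))
     \<longlonglongrightarrow> (1/2) *\<^sub>R G2 h0 h0"
proof -
  interpret G2: bounded_linear G2 by (rule has_derivative_bounded_linear[OF G2])
  have th: "(\<lambda>k. t k *\<^sub>R h k) \<longlonglongrightarrow> 0" using tendsto_scaleR[OF t(2) h] by simp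
  let ?q = "\<lambda>k. (1 / (t k)\<^sup>2) *\<^sub>R (g (z + t k *\<^sub>R h k) - g z - t k *\<^sub>R G z (h k))"
  have "(\<lambda>k. ?q k - (1/2) *\<^sub>R G2 (h k) (h k)) \<longlonglongrightarrow> 0"
  proof (rule tendstoI)
    fix e :: real assume e: "e > 0"
    \<comment> \<open>The directions \<open>h k\<close> are eventually bounded by \<open>B\<close>,
      so the remainder divided by \<open>(t k)\<^sup>2\<close> is at most
      \<open>\<epsilon> * B\<^sup>2\<close>, that is, half of \<open>e\<close>.\<close>
    define B where "B = norm h0 + 1"
    have B: "B > 0" by (simp add: B_def add_nonneg_pos)
    have evB: "\<forall>\<^sub>F k in sequentially. norm (h k) < B"
      using tendsto_norm[OF h] by (rule order_tendstoD) (simp add: B_def)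
    define \<epsilon> where "\<epsilon> = e / (2 * B\<^sup>2)"
    have eps: "\<epsilon> > 0" using e B by (simp add: \<epsilon>_def)
    obtain \<delta> where \<delta>: "\<delta> > 0" "\<And>h. norm h < \<delta> \<Longrightarrow>
        norm (g (z + h) - g z - G z h - (1/2) *\<^sub>R G2 h h) \<le> \<epsilon> * (norm h)\<^sup>2"
      using second_order_expansion[OF S der G2 eps] by blast
    have "\<forall>\<^sub>F k in sequentially. norm (t k *\<^sub>R h k) < \<delta>"
      using tendsto_norm[OF th] by (rule order_tendstoD) (use \<delta> in simp)
    then show "\<forall>\<^sub>F k in sequentially. dist (?q k - (1/2) *\<^sub>R G2 (h k) (h k)) 0 < e"
      using evB
    proof eventually_elim
      case (elim k)
      define R where "R = g (z + t k *\<^sub>R h k) - g z - G z (t k *\<^sub>R h k) - (1/2) *\<^sub>R G2 (t k *\<^sub>R h k) (t k *\<^sub>R h k)"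
      have "norm R \<le> \<epsilon> * (norm (t k *\<^sub>R h k))\<^sup>2" using \<delta>(2)[OF elim(1)] by (simp add: R_def)
      also have "\<dots> = (t k)\<^sup>2 * (\<epsilon> * (norm (h k))\<^sup>2)" by (simp add: power_mult_distrib)
      finally have "norm R / (t k)\<^sup>2 \<le> \<epsilon> * (norm (h k))\<^sup>2"
        using t(1)[of k] by (simp add: field_simps)
      also have "\<dots> \<le> \<epsilon> * B\<^sup>2"
        using elim eps by (intro mult_left_mono power_mono) auto
      also have "\<dots> < e" using e B by (simp add: \<epsilon>_def)
      finally have *: "norm R / (t k)\<^sup>2 < e" .
      have "?q k - (1/2) *\<^sub>R G2 (h k) (h k) = (1 / (t k)\<^sup>2) *\<^sub>R R"
        using t(1)[of k]
        by (simp add: R_def G2.scaleR blinfun.scaleR_left blinfun.scaleR_right scaleR_right_diff_distrib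
            power2_eq_square)
      then show ?case using * t(1)[of k] by (simp add: norm_divide)
    qed
  qed
  moreover have "(\<lambda>k. (1/2) *\<^sub>R G2 (h k) (h k)) \<longlonglongrightarrow> (1/2) *\<^sub>R G2 h0 h0"
    by (intro tendsto_intros G2.tendsto h)
  ultimately have "(\<lambda>k. (?q k - (1/2) *\<^sub>R G2 (h k) (h k)) + (1/2) *\<^sub>R G2 (h k) (h k))
     \<longlonglongrightarrow> 0 + (1/2) *\<^sub>R G2 h0 h0"
    by (rule tendsto_add)
  then show ?thesis by simp
qed

section \<open>Curvature inequality from sequences\<close>

text \<open>For every \<open>\<epsilon>\<close> a late index \<open>k\<close> supplies a competitor
  to the infimum on the left and to the supremum on the right at once, so the inequality
  \<open>le\<close> along the sequence passes to both limits.\<close>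

lemma curvature_comparison:
  fixes P :: "'m::real_inner set" and C :: "'y::real_inner set"
  assumes t: "\<And>k::nat. t k > 0" "t \<longlonglongrightarrow> 0"
    and w: "\<And>k. pb + t k *\<^sub>R w k \<in> P" "w \<longlonglongrightarrow> w0"
    and v: "v \<longlonglongrightarrow> v0"
    and mu: "\<And>k. \<mu> k \<in> limiting_normal_cone C (yb + t k *\<^sub>R v k)" "\<mu> \<longlonglongrightarrow> lam"
    and le: "\<forall>\<^sub>F k in sequentially. inner lam (v k - v0) / t k \<le> inner q (w k - w0) / t k + a k"
    and a: "a \<longlonglongrightarrow> a0"
  shows "lower_curvature C lam yb v0 \<le> ereal a0 + upper_curvature P q pb w0"
proof -
  let ?lo = "\<lambda>\<epsilon>. Inf {ereal (inner lam (v' - v0) / \<tau>) | \<tau> v'.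
       0 < \<tau> \<and> \<tau> < \<epsilon> \<and> norm (v' - v0) < \<epsilon> \<and>
       (\<exists>\<mu>\<in>limiting_normal_cone C (yb + \<tau> *\<^sub>R v'). dist lam \<mu> < \<epsilon>)}"
  let ?up = "\<lambda>\<epsilon>. Sup {ereal (inner q (v' - w0) / \<tau>) | \<tau> v'.
       0 < \<tau> \<and> \<tau> < \<epsilon> \<and> norm (v' - w0) < \<epsilon> \<and> pb + \<tau> *\<^sub>R v' \<in> P}"
  have key: "?lo \<epsilon> \<le> ereal (a0 + \<epsilon>) + ?up \<epsilon>" if e: "\<epsilon> > 0" for \<epsilon>
  proof -
    have "\<forall>\<^sub>F k in sequentially. t k < \<epsilon>" using t(2) e by (rule order_tendstoD)
    moreover have "\<forall>\<^sub>F k in sequentially. dist (w k) w0 < \<epsilon>" "\<forall>\<^sub>F k in sequentially. dist (v k) v0 < \<epsilon>"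
      "\<forall>\<^sub>F k in sequentially. dist lam (\<mu> k) < \<epsilon>"
      using w(2) v mu(2) e by (auto dest: tendstoD simp: dist_commute[of lam])
    moreover have "\<forall>\<^sub>F k in sequentially. a k < a0 + \<epsilon>" using a by (rule order_tendstoD) (use e in simp)
    ultimately have "\<forall>\<^sub>F k in sequentially. inner lam (v k - v0) / t k \<le> inner q (w k - w0) / t k + a k \<and>
        t k < \<epsilon> \<and> dist (w k) w0 < \<epsilon> \<and> dist (v k) v0 < \<epsilon> \<and>
        dist lam (\<mu> k) < \<epsilon> \<and> a k < a0 + \<epsilon>" using le by eventually_elim simp
    then obtain k where le_k: "inner lam (v k - v0) / t k \<le> inner q (w k - w0) / t k + a k"
      and k: "t k < \<epsilon>" "dist (w k) w0 < \<epsilon>" "dist (v k) v0 < \<epsilon>"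
        "dist lam (\<mu> k) < \<epsilon>" "a k < a0 + \<epsilon>"
      using eventually_happens'[OF sequentially_bot] by blast
    have "?lo \<epsilon> \<le> ereal (inner lam (v k - v0) / t k)"
      using k(1,4) k(3)[unfolded dist_norm] t(1)[of k] mu(1)[of k]
      by (intro Inf_lower CollectI exI[of _ "t k"] exI[of _ "v k"] conjI refl bexI[of _ "\<mu> k"])
    also have "\<dots> \<le> ereal (inner q (w k - w0) / t k + (a0 + \<epsilon>))"
      using le_k k by simp
    also have "\<dots> = ereal (a0 + \<epsilon>) + ereal (inner q (w k - w0) / t k)"
      by simp
    also have "\<dots> \<le> ereal (a0 + \<epsilon>) + ?up \<epsilon>"
      using k(1) k(2)[unfolded dist_norm] t(1)[of k] w(1)[of k]
      by (intro add_left_mono Sup_upper CollectI exI[of _ "t k"] exI[of _ "w k"] conjI refl)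
    finally show ?thesis .
  qed
  have "((\<lambda>\<epsilon>. a0 + \<epsilon>) \<longlongrightarrow> a0 + 0) (at_right (0::real))"
    by (intro tendsto_intros)
  then have "((\<lambda>\<epsilon>. ereal (a0 + \<epsilon>)) \<longlongrightarrow> ereal a0) (at_right 0)"
    by simp
  \<comment> \<open>One summand has a finite limit, so the sum converges even where the upper
    curvature is infinite.\<close>
  then have "((\<lambda>\<epsilon>. ereal (a0 + \<epsilon>) + ?up \<epsilon>) \<longlongrightarrow> ereal a0 + upper_curvature P q pb w0) (at_right 0)"
    by (intro tendsto_add_ereal_general2 upper_curvature_tendsto) auto
  moreover have "\<forall>\<^sub>F \<epsilon> in at_right 0. ?lo \<epsilon> \<le> ereal (a0 + \<epsilon>) + ?up \<epsilon>"
    using key by (auto simp: eventually_at_right_less intro: eventually_mono[OF eventually_at_right_less])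
  ultimately show ?thesis
    by (intro tendsto_le[OF _ _ lower_curvature_tendsto]) auto
qed

section \<open>Approximate multipliers from a penalised minimisation\<close>

text \<open>The minimiser has a value at most \<open>\<eta>\<^sup>2 * r\<close>, since
  \<open>x0\<close> does; the quadratic term therefore keeps it within \<open>\<eta> * r\<close> of
  \<open>x0\<close> and contributes at most \<open>2 * \<eta>\<close> to the gradient. The
  multipliers are the unit vector from \<open>y1\<close> to \<open>f1 x\<close> and the scaled
  residual of \<open>f2\<close>; \<open>calm\<close> bounds the latter independently of the penalty
  parameter.\<close>

lemma approximate_multipliers:
  fixes f1 :: "'n::euclidean_space \<Rightarrow> 'a::euclidean_space" and f2 :: "'n \<Rightarrow> 'b::euclidean_space"
  assumes C1: "closed C1" "C1 \<noteq> {}" and C2: "closed C2"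
    and r: "0 < r" and eta: "0 < \<eta>" "\<eta> < 1"
    and start: "f2 x0 \<in> C2" "infdist (f1 x0) C1 \<le> \<eta>\<^sup>2 * r"
    and infeas: "\<And>x. x \<in> cball x0 r \<Longrightarrow> \<not> (f1 x \<in> C1 \<and> f2 x \<in> C2)"
    and d1: "\<And>x. x \<in> cball x0 r \<Longrightarrow> (f1 has_derivative f1' x) (at x)"
    and d2: "\<And>x. x \<in> cball x0 r \<Longrightarrow> (f2 has_derivative f2' x) (at x)"
    and lip: "\<And>x y. x \<in> cball x0 r \<Longrightarrow> y \<in> cball x0 r \<Longrightarrow> norm (f1 x - f1 y) \<le> L * norm (x - y)"
    and L: "0 \<le> L"
    and calm: "\<And>x. x \<in> cball x0 r \<Longrightarrow> f2 x \<notin> C2 \<Longrightarrow> \<exists>\<xi>. f2 \<xi> \<in> C2 \<and> dist \<xi> x \<le> K * infdist (f2 x) C2"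
    and K: "0 < K" and nu: "0 < \<nu>"
  obtains x y1 y2 l1 l2 where "dist x x0 \<le> \<eta> * r" "y1 \<in> C1" "y2 \<in> C2"
    "norm l1 = 1" "norm l2 \<le> 2 * (L + 2) * K"
    "l1 \<in> regular_normal_cone C1 y1" "l2 \<in> regular_normal_cone C2 y2"
    "f1 x - y1 = norm (f1 x - y1) *\<^sub>R l1" "norm (f1 x - y1) \<le> \<eta>\<^sup>2 * r" "norm (f2 x - y2) \<le> \<nu>"
    "\<And>u. \<bar>inner l1 (f1' x u) + inner l2 (f2' x u)\<bar> \<le> 2 * \<eta> * norm u"
proof -
  have C2ne: "C2 \<noteq> {}" using start(1) by blast
  have cont1: "continuous_on (cball x0 r) f1" and cont2: "continuous_on (cball x0 r) f2"
    using has_derivative_continuous[OF d1] has_derivative_continuous[OF d2]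
    by (simp_all add: continuous_at_imp_continuous_on)
  have ne: "cball x0 r \<noteq> {}" using r by auto
  \<comment> \<open>Infeasibility on a compact ball gives a positive lower bound for the total
    residual; once the second residual is below \<open>m\<close>, the first cannot vanish.\<close>
  obtain m where m: "m > 0" "\<And>x. x \<in> cball x0 r \<Longrightarrow> m \<le> infdist (f1 x) C1 + infdist (f2 x) C2"
  proof -
    have "continuous_on (cball x0 r) (\<lambda>x. infdist (f1 x) C1 + infdist (f2 x) C2)"
      by (intro continuous_intros cont1 cont2)
    then obtain z where z: "z \<in> cball x0 r"
      "\<And>y. y \<in> cball x0 r \<Longrightarrow> infdist (f1 z) C1 + infdist (f2 z) C2 \<le> infdist (f1 y) C1 + infdist (f2 y) C2"
      using continuous_attains_inf[OF compact_cball ne] by blast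
    have "infdist (f1 z) C1 > 0 \<or> infdist (f2 z) C2 > 0"
      using infeas[OF z(1)] infdist_pos_not_in_closed[OF C1, of "f1 z"]
        infdist_pos_not_in_closed[OF C2 C2ne, of "f2 z"] by blast
    then have "infdist (f1 z) C1 + infdist (f2 z) C2 > 0"
      using infdist_nonneg[of "f1 z" C1] infdist_nonneg[of "f2 z" C2] by linarith
    with z(2) that show ?thesis by blast
  qed
  \<comment> \<open>Three demands: the tolerance \<open>\<nu>\<close>, a value below
    \<open>m\<close> for a nonzero residual in \<open>C1\<close>, and room for a move of length
    \<open>K * \<nu>'\<close> inside the ball.\<close>
  define \<nu>' where "\<nu>' = Min {\<nu>, m / 2, (1 - \<eta>) * r / K}"
  have nu': "\<nu>' > 0" "\<nu>' \<le> \<nu>" "\<nu>' < m" "K * \<nu>' \<le> (1 - \<eta>) * r"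
  proof -
    show "\<nu>' > 0" using nu m r eta K by (simp add: \<nu>'_def)
    show "\<nu>' \<le> \<nu>" unfolding \<nu>'_def by (rule Min_le) auto
    have "\<nu>' \<le> m / 2" unfolding \<nu>'_def by (rule Min_le) auto
    then show "\<nu>' < m" using m by simp
    have "\<nu>' \<le> (1 - \<eta>) * r / K" unfolding \<nu>'_def by (rule Min_le) auto
    then show "K * \<nu>' \<le> (1 - \<eta>) * r" using K by (simp add: field_simps)
  qed
  \<comment> \<open>Large enough that a minimiser of the penalty function below satisfies \<open>f2 x \<in> C2\<close> up to \<open>\<nu>'\<close>.\<close>
  define \<rho> where "\<rho> = 2 * (\<eta>\<^sup>2 * r) / \<nu>'\<^sup>2"
  have rho: "\<rho> > 0" using eta r nu' by (simp add: \<rho>_def)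
  define F where "F x = infdist (f1 x) C1 + \<rho> / 2 * (infdist (f2 x) C2)\<^sup>2 + (norm (x - x0))\<^sup>2 / r" for x
  have "continuous_on (cball x0 r) F"
    unfolding F_def using r by (auto intro!: continuous_intros cont1 cont2)
  then obtain x where x: "x \<in> cball x0 r" and xmin: "\<And>y. y \<in> cball x0 r \<Longrightarrow> F x \<le> F y"
    using continuous_attains_inf[OF compact_cball ne] by blast
  have "F x \<le> F x0" using xmin r by simp
  also have "F x0 \<le> \<eta>\<^sup>2 * r" using start by (simp add: F_def)
  finally have Fx: "F x \<le> \<eta>\<^sup>2 * r" .
  have nonneg: "0 \<le> infdist (f1 x) C1" "0 \<le> \<rho> / 2 * (infdist (f2 x) C2)\<^sup>2" "0 \<le> (norm (x - x0))\<^sup>2 / r"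
    using rho r by (auto simp: infdist_nonneg)
  have near: "norm (x - x0) \<le> \<eta> * r"
  proof -
    have "(norm (x - x0))\<^sup>2 / r \<le> \<eta>\<^sup>2 * r" using Fx nonneg unfolding F_def by linarith
    then have "(norm (x - x0))\<^sup>2 \<le> (\<eta> * r)\<^sup>2" using r by (simp add: field_simps power2_eq_square)
    then show ?thesis by (rule power2_le_imp_le) (use eta r in simp)
  qed
  define n where "n = infdist (f2 x) C2"
  have n_le: "n \<le> \<nu>'"
  proof -
    have "\<rho> / 2 * n\<^sup>2 \<le> \<eta>\<^sup>2 * r" using Fx nonneg unfolding F_def n_def by linarith
    then have "\<rho> * n\<^sup>2 \<le> \<rho> * \<nu>'\<^sup>2" using nu' by (simp add: \<rho>_def)
    then have "n\<^sup>2 \<le> \<nu>'\<^sup>2" using rho by simp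
    then show ?thesis by (rule power2_le_imp_le) (use nu' in simp)
  qed
  have pos1: "infdist (f1 x) C1 > 0" using m(2)[OF x] n_le nu' by (simp add: n_def)
  obtain y1 where y1: "y1 \<in> C1" "\<And>y. y \<in> C1 \<Longrightarrow> dist (f1 x) y1 \<le> dist (f1 x) y"
    using distance_attains_inf[OF C1] by blast
  obtain y2 where y2: "y2 \<in> C2" "\<And>y. y \<in> C2 \<Longrightarrow> dist (f2 x) y2 \<le> dist (f2 x) y"
    using distance_attains_inf[OF C2 C2ne] by blast
  have dist1: "norm (f1 x - y1) = infdist (f1 x) C1"
    using y1 C1 by (metis antisym dist_norm infdist_attains_inf infdist_le)
  have dist2: "norm (f2 x - y2) = n"
    using y2 C2 C2ne unfolding n_def by (metis antisym dist_norm infdist_attains_inf infdist_le)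
  define l1 where "l1 = sgn (f1 x - y1)"
  define l2 where "l2 = \<rho> *\<^sub>R (f2 x - y2)"
  have f1y1: "f1 x - y1 \<noteq> 0" using pos1 dist1 by auto
  \<comment> \<open>The minimiser is compared with a point \<open>\<xi>\<close> that satisfies the
    second constraint at distance at most \<open>K * n\<close>. The saving
    \<open>\<rho> / 2 * n\<^sup>2\<close> is bounded by the growth of the other terms, which is
    linear in \<open>n\<close>, and one factor \<open>n\<close> cancels. The product
    \<open>\<rho> * n\<close> is the norm of \<open>l2\<close>.\<close>
  have rn: "\<rho> * n \<le> 2 * (L + 2) * K"
  proof (cases "f2 x \<in> C2")
    case True
    then have "n = 0" by (simp add: n_def)
    then show ?thesis using L K by simp
  next
    case False
    then have npos: "n > 0" unfolding n_def by (rule infdist_pos_not_in_closed[OF C2 C2ne])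
    obtain \<xi> where \<xi>: "f2 \<xi> \<in> C2" "dist \<xi> x \<le> K * n"
      using calm[OF x False] unfolding n_def by blast
    have "K * n \<le> K * \<nu>'" using n_le K by simp
    then have "norm (\<xi> - x0) \<le> r"
      using near \<xi>(2) nu'(4) norm_triangle_ineq[of "\<xi> - x" "x - x0"]
      by (simp add: dist_norm algebra_simps)
    then have \<xi>b: "\<xi> \<in> cball x0 r" by (simp add: dist_norm norm_minus_commute)
    have "F x \<le> F \<xi>" using xmin \<xi>b by blast
    moreover have "infdist (f1 \<xi>) C1 \<le> infdist (f1 x) C1 + L * norm (\<xi> - x)"
      using infdist_triangle[of "f1 \<xi>" C1 "f1 x"] lip[OF \<xi>b x] by (simp add: dist_norm)
    ultimately have "\<rho> / 2 * n\<^sup>2 \<le> L * norm (\<xi> - x) + ((norm (\<xi> - x0))\<^sup>2 - (norm (x - x0))\<^sup>2) / r"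
      using \<xi>(1) by (simp add: F_def n_def diff_divide_distrib) argo
    \<comment> \<open>On the ball the localising term has Lipschitz constant 2, as the two distances
      to \<open>x0\<close> sum to at most \<open>2 * r\<close>.\<close>
    also have "((norm (\<xi> - x0))\<^sup>2 - (norm (x - x0))\<^sup>2) / r \<le> 2 * norm (\<xi> - x)"
    proof -
      have "(norm (\<xi> - x0))\<^sup>2 - (norm (x - x0))\<^sup>2
          = (norm (\<xi> - x0) - norm (x - x0)) * (norm (\<xi> - x0) + norm (x - x0))"
        by (simp add: power2_eq_square algebra_simps)
      also have "\<dots> \<le> norm (\<xi> - x) * (2 * r)"
      proof (rule mult_mono)
        show "norm (\<xi> - x0) - norm (x - x0) \<le> norm (\<xi> - x)"
          using norm_triangle_ineq[of "\<xi> - x" "x - x0"] by simp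
        show "norm (\<xi> - x0) + norm (x - x0) \<le> 2 * r"
          using \<xi>b x by (simp add: dist_norm norm_minus_commute)
      qed auto
      finally show ?thesis using r by (simp add: field_simps)
    qed
    finally have "\<rho> / 2 * n\<^sup>2 \<le> (L + 2) * norm (\<xi> - x)" by (simp add: algebra_simps)
    also have "\<dots> \<le> (L + 2) * (K * n)"
      using \<xi>(2) L by (intro mult_left_mono) (auto simp: dist_norm)
    finally have "(\<rho> * n) * n \<le> (2 * (L + 2) * K) * n" by (simp add: power2_eq_square algebra_simps)
    then show ?thesis using npos by simp
  qed
  \<comment> \<open>With the nearest points frozen, \<open>\<psi>\<close> majorises \<open>F\<close>
    and agrees with it at \<open>x\<close>, so \<open>x\<close> minimises \<open>\<psi>\<close> on
    the ball as well. It is differentiable at \<open>x\<close> because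
    \<open>f1 x \<noteq> y1\<close>.\<close>
  define \<psi> where "\<psi> x' = norm (f1 x' - y1) + \<rho> / 2 * (inner (f2 x' - y2) (f2 x' - y2))
      + inner (x' - x0) (x' - x0) / r" for x'
  have Fpsi: "F x' \<le> \<psi> x'" for x'
  proof -
    have "infdist (f1 x') C1 \<le> norm (f1 x' - y1)" "infdist (f2 x') C2 \<le> norm (f2 x' - y2)"
      using y1 y2 by (auto intro: infdist_le simp flip: dist_norm)
    then show ?thesis unfolding F_def \<psi>_def power2_norm_eq_inner[symmetric]
      using rho by (intro add_mono mult_left_mono power_mono) (auto simp: infdist_nonneg)
  qed
  have psix: "\<psi> x = F x"
    unfolding F_def \<psi>_def power2_norm_eq_inner[symmetric] by (simp add: dist1 dist2 n_def)
  \<comment> \<open>\<open>\<eta> < 1\<close> makes the minimiser interior, as the first-order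
    condition requires.\<close>
  have x_ball: "x \<in> ball x0 r"
    using near mult_strict_right_mono[OF eta(2) r]
    by (simp add: dist_norm norm_minus_commute)
  have df1: "((\<lambda>z. f1 z - y1) has_derivative f1' x) (at x)"
    using has_derivative_diff[OF d1[OF x] has_derivative_const[of y1]] by simp
  have df2: "((\<lambda>z. f2 z - y2) has_derivative f2' x) (at x)"
    using has_derivative_diff[OF d2[OF x] has_derivative_const[of y2]] by simp
  have "(norm has_derivative (\<lambda>u. inner u l1)) (at (f1 x - y1))"
    unfolding l1_def using f1y1 by (rule has_derivative_norm)
  from has_derivative_compose[OF df1 this]
  have dn: "((\<lambda>z. norm (f1 z - y1)) has_derivative (\<lambda>u. inner (f1' x u) l1)) (at x)" .
  have df0: "((\<lambda>z. z - x0) has_derivative (\<lambda>u. u)) (at x)"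
    using has_derivative_diff[OF has_derivative_ident has_derivative_const[of x0]] by simp
  note quad2 = has_derivative_mult_right[OF has_derivative_inner[OF df2 df2], of "\<rho> / 2"]
  note quad0 = has_derivative_mult_right[OF has_derivative_inner[OF df0 df0], of "inverse r"]
  have "(\<psi> has_derivative (\<lambda>u. inner (f1' x u) l1 + inner l2 (f2' x u) + 2 * inner (x - x0) u / r)) (at x)"
    unfolding \<psi>_def l2_def
    by (rule has_derivative_eq_rhs,
        rule has_derivative_add[OF has_derivative_add[OF dn quad2] quad0, folded divide_inverse_commute])
      (auto simp: inner_commute field_simps inner_diff_right)
  then have zero: "(\<lambda>u. inner (f1' x u) l1 + inner l2 (f2' x u) + 2 * inner (x - x0) u / r) = (\<lambda>u. 0)"
  proof (rule differential_zero_maxmin[OF x_ball open_ball])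
    show "(\<forall>y\<in>ball x0 r. \<psi> y \<le> \<psi> x) \<or> (\<forall>y\<in>ball x0 r. \<psi> x \<le> \<psi> y)"
      using xmin Fpsi psix by (metis ball_subset_cball order_trans subsetD)
  qed
  show ?thesis
  proof (rule that[of x y1 y2 l1 l2])
    show "dist x x0 \<le> \<eta> * r" using near by (simp add: dist_norm)
    show "norm l1 = 1" using f1y1 by (simp add: l1_def norm_sgn)
    show "norm l2 \<le> 2 * (L + 2) * K" using rn rho dist2 by (simp add: l2_def)
    show "l1 \<in> regular_normal_cone C1 y1"
      unfolding l1_def sgn_div_norm using y1 by (intro scaled_proximal_regular_normal) auto
    show "l2 \<in> regular_normal_cone C2 y2"
      unfolding l2_def using y2 rho by (intro scaled_proximal_regular_normal) auto
    show "f1 x - y1 = norm (f1 x - y1) *\<^sub>R l1" using f1y1 by (simp add: l1_def sgn_div_norm)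
    show "norm (f1 x - y1) \<le> \<eta>\<^sup>2 * r" using Fx nonneg unfolding F_def dist1 by linarith
    show "norm (f2 x - y2) \<le> \<nu>" using dist2 n_le nu' by simp
    fix u
    have "inner l1 (f1' x u) + inner l2 (f2' x u) = - (2 * inner (x - x0) u / r)"
      using fun_cong[OF zero, of u] by (simp add: inner_commute)
    moreover have "\<bar>2 * inner (x - x0) u / r\<bar> \<le> 2 * \<eta> * norm u"
    proof -
      have "\<bar>inner (x - x0) u\<bar> \<le> \<eta> * r * norm u"
        using near by (intro order_trans[OF Cauchy_Schwarz_ineq2] mult_right_mono) auto
      then show ?thesis using r by (simp add: abs_mult field_simps)
    qed
    ultimately show "\<bar>inner l1 (f1' x u) + inner l2 (f2' x u)\<bar> \<le> 2 * \<eta> * norm u" by simp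
  qed (use y1 y2 in auto)
qed

section \<open>Local Lipschitz bound and solutions near a given point\<close>

text \<open>Continuity of \<open>G\<close> at the single point \<open>z\<close> already bounds its
  norm by \<open>norm (G z) + 1\<close> nearby, and this is a Lipschitz constant on a convex
  ball.\<close>

lemma locally_lipschitz_at:
  fixes g :: "'z::real_normed_vector \<Rightarrow> 'y::real_normed_vector" and G :: "'z \<Rightarrow> 'z \<Rightarrow>\<^sub>L 'y"
  assumes S: "open S" "z \<in> S" and der: "\<And>z. z \<in> S \<Longrightarrow> (g has_derivative blinfun_apply (G z)) (at z)"
    and cont: "isCont G z"
  obtains \<delta> L where "\<delta> > 0" "L \<ge> 0" "ball z \<delta> \<subseteq> S"
    "\<And>x y. x \<in> ball z \<delta> \<Longrightarrow> y \<in> ball z \<delta> \<Longrightarrow> norm (g x - g y) \<le> L * norm (x - y)"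
proof -
  obtain d1 where d1: "d1 > 0" "ball z d1 \<subseteq> S" using S openE by blast
  have "\<exists>d>0. \<forall>x. dist x z < d \<longrightarrow> dist (G x) (G z) < 1"
    using cont unfolding continuous_at_eps_delta by (elim allE[of _ 1]) simp
  then obtain d2 where d2: "d2 > 0" "\<And>x. dist x z < d2 \<Longrightarrow> dist (G x) (G z) < 1" by blast
  have sub: "ball z (min d1 d2) \<subseteq> S" using d1 by auto
  show ?thesis
  proof (rule that[of "min d1 d2" "norm (G z) + 1"])
    fix x y assume xy: "x \<in> ball z (min d1 d2)" "y \<in> ball z (min d1 d2)"
    show "norm (g x - g y) \<le> (norm (G z) + 1) * norm (x - y)"
    proof (rule differentiable_bound[OF convex_ball _ _ xy])
      fix \<xi> assume \<xi>: "\<xi> \<in> ball z (min d1 d2)"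
      then show "(g has_derivative blinfun_apply (G \<xi>)) (at \<xi> within ball z (min d1 d2))"
        using der sub by (blast intro: has_derivative_at_withinI)
      have "norm (G \<xi> - G z) < 1" using d2(2)[of \<xi>] \<xi> by (simp add: dist_norm norm_minus_commute)
      then show "onorm (blinfun_apply (G \<xi>)) \<le> norm (G z) + 1"
        using norm_triangle_sub[of "G \<xi>" "G z"] by (simp flip: norm_blinfun.rep_eq)
    qed
  qed (use d1 d2 sub in auto)
qed

lemma infdist_lessD:
  assumes "S \<noteq> {}" "infdist x S < c"
  shows "\<exists>a\<in>S. dist a x < c"
proof -
  have "dist x ` S \<noteq> {}" "Inf (dist x ` S) < c" using assms by (simp_all add: infdist_def)
  from cInf_lessD[OF this] show ?thesis by (auto simp: dist_commute)
qed

text \<open>The infimum in the distance need not be attained. With \<open>\<kappa> + 1\<close> the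
  estimate is strict for a positive residual and yields an actual solution; for residual zero
  \<open>x\<close> itself serves.\<close>

lemma robinson_stable_approx:
  assumes "robinson_stable P h C pb xb" "closed C" "C \<noteq> {}"
  obtains K \<delta> where "K > 0" "\<delta> > 0"
    "\<And>p x. p \<in> P \<Longrightarrow> dist p pb < \<delta> \<Longrightarrow> dist x xb < \<delta> \<Longrightarrow> \<exists>\<xi>. h p \<xi> \<in> C \<and> dist \<xi> x \<le> K * infdist (h p x) C"
proof -
  obtain \<kappa> U V where k: "\<kappa> \<ge> 0" and U: "open U" "xb \<in> U" and V: "open V" "pb \<in> V"
    and *: "\<And>p x. p \<in> P \<inter> V \<Longrightarrow> x \<in> U \<Longrightarrow>
      {\<xi>. h p \<xi> \<in> C} \<noteq> {} \<and> infdist x {\<xi>. h p \<xi> \<in> C} \<le> \<kappa> * infdist (h p x) C"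
    using assms(1) unfolding robinson_stable_def by blast
  obtain a where a: "a > 0" "ball xb a \<subseteq> U" using U openE by blast
  obtain b where b: "b > 0" "ball pb b \<subseteq> V" using V openE by blast
  show ?thesis
  proof (rule that[of "\<kappa> + 1" "min a b"])
    fix p x assume p: "p \<in> P" "dist p pb < min a b" and x: "dist x xb < min a b"
    show "\<exists>\<xi>. h p \<xi> \<in> C \<and> dist \<xi> x \<le> (\<kappa> + 1) * infdist (h p x) C"
    proof (cases "h p x \<in> C")
      case True
      then show ?thesis by (intro exI[of _ x]) simp
    next
      case False
      then have pos: "infdist (h p x) C > 0" by (rule infdist_pos_not_in_closed[OF assms(2,3)])
      have "p \<in> P \<inter> V" "x \<in> U" using p x a b by (auto simp: dist_commute)
      from *[OF this] have ne: "{\<xi>. h p \<xi> \<in> C} \<noteq> {}"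
        and le: "infdist x {\<xi>. h p \<xi> \<in> C} \<le> \<kappa> * infdist (h p x) C" by auto
      have "infdist x {\<xi>. h p \<xi> \<in> C} < (\<kappa> + 1) * infdist (h p x) C"
        using le pos by (simp add: algebra_simps)
      from infdist_lessD[OF ne this] show ?thesis by (auto intro: less_imp_le)
    qed
  qed (use k a b in auto)
qed

lemma infdist_Times_ge:
  fixes z :: "'a::heine_borel \<times> 'b::heine_borel"
  assumes "closed A" "closed B" "A \<noteq> {}" "B \<noteq> {}"
  shows "infdist (fst z) A \<le> infdist z (A \<times> B)" "infdist (snd z) B \<le> infdist z (A \<times> B)"
proof -
  obtain y where y: "y \<in> A \<times> B" "infdist z (A \<times> B) = dist z y"
    using infdist_attains_inf[of "A \<times> B" z] assms by (auto simp: closed_Times)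
  show "infdist (fst z) A \<le> infdist z (A \<times> B)"
    using y by (auto intro!: infdist_le2[of "fst y"] dist_fst_le)
  show "infdist (snd z) B \<le> infdist z (A \<times> B)"
    using y by (auto intro!: infdist_le2[of "snd y"] dist_snd_le)
qed

section \<open>Multipliers for the split system\<close>

text \<open>\<open>stable2\<close> and \<open>second_order\<close> are conditions (b) and (c); (a)
  enters later as \<open>directional\<close>. The term \<open>inner lam (G2 (w, u) (w, u))\<close>
  is the Hessian form of the scalar function obtained by pairing \<open>g\<close> with
  \<open>lam\<close>, and the \<open>adjoint\<close> term is the transposed partial derivative in
  \<open>p\<close> applied to \<open>lam\<close>.\<close>

locale split_system =
  fixes P :: "'m::euclidean_space set" and pb :: 'm and xb :: "'n::euclidean_space"
    and g :: "'m \<times> 'n \<Rightarrow> 'a::euclidean_space \<times> 'b::euclidean_space"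
    and C1 :: "'a set" and C2 :: "'b set"
    and G :: "'m \<times> 'n \<Rightarrow> ('m \<times> 'n) \<Rightarrow>\<^sub>L ('a \<times> 'b)"
    and G2 :: "'m \<times> 'n \<Rightarrow> ('m \<times> 'n) \<Rightarrow>\<^sub>L ('a \<times> 'b)"
    and S :: "('m \<times> 'n) set"
  assumes closed1: "closed C1" and closed2: "closed C2"
    and feas: "g (pb, xb) \<in> C1 \<times> C2"
    and S: "open S" "(pb, xb) \<in> S"
    and g_deriv: "\<And>z. z \<in> S \<Longrightarrow> (g has_derivative blinfun_apply (G z)) (at z)"
    and G_deriv: "(G has_derivative G2) (at (pb, xb))"
    and stable2: "robinson_stable P (\<lambda>p x. snd (g (p, x))) C2 pb xb"
    and second_order: "\<And>w u lam. (w, u) \<noteq> (0, 0) \<Longrightarrow> w \<in> tangent_cone P pb \<Longrightarrow>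
        G (pb, xb) (w, u) \<in> tangent_cone (C1 \<times> C2) (g (pb, xb)) \<Longrightarrow>
        lam \<in> dir_limiting_normal_cone (C1 \<times> C2) (g (pb, xb)) (G (pb, xb) (w, u)) \<Longrightarrow>
        (\<And>u'. inner lam (G (pb, xb) (0, u')) = 0) \<Longrightarrow>
        lower_curvature (C1 \<times> C2) lam (g (pb, xb)) (G (pb, xb) (w, u))
          \<le> ereal (inner lam (G2 (w, u) (w, u)) / 2)
            + upper_curvature P (adjoint (\<lambda>w'. G (pb, xb) (w', 0)) lam) pb w \<Longrightarrow>
        fst lam = 0"
begin

lemma ne: "C1 \<noteq> {}" "C2 \<noteq> {}" using feas by auto

lemma closed_C: "closed (C1 \<times> C2)" using closed1 closed2 by (rule closed_Times)

lemma isCont_G: "isCont G (pb, xb)" using G_deriv by (rule has_derivative_continuous)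

text \<open>By \<open>stable2\<close> the point \<open>x\<close> can be moved to some
  \<open>x0\<close> satisfying the second constraint, at a cost proportional to the residual; the
  penalised problem is then posed on the ball of radius \<open>r / 2\<close> about
  \<open>x0\<close>. The bounds \<open>\<delta>\<close> and \<open>M\<close> are chosen before
  \<open>p\<close>, \<open>x\<close>, \<open>r\<close>, \<open>\<eta>\<close>, \<open>\<nu>\<close>,
  so multipliers along a sequence stay bounded.\<close>

lemma multipliers_near_infeasible_point:
  "\<exists>\<delta>>0. \<exists>M>0. \<forall>p x r \<eta> \<nu>. p \<in> P \<longrightarrow> dist p pb < \<delta> \<longrightarrow> dist x xb < \<delta> \<longrightarrow> 0 < r \<longrightarrow> r < \<delta> \<longrightarrow>
     0 < \<eta> \<longrightarrow> \<eta> < 1 \<longrightarrow> 0 < \<nu> \<longrightarrow> M * infdist (g (p, x)) (C1 \<times> C2) \<le> \<eta>\<^sup>2 * r \<longrightarrow>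
     (\<forall>\<xi>. dist \<xi> x < r \<longrightarrow> g (p, \<xi>) \<notin> C1 \<times> C2) \<longrightarrow>
     (\<exists>X y l. dist X x \<le> \<eta> * r \<and> y \<in> C1 \<times> C2 \<and> norm (fst l) = 1 \<and> norm (snd l) \<le> M \<and>
        l \<in> regular_normal_cone (C1 \<times> C2) y \<and>
        (\<exists>c\<ge>0. fst (g (p, X)) - fst y = c *\<^sub>R fst l) \<and>
        norm (g (p, X) - y) \<le> \<eta>\<^sup>2 * r + \<nu> \<and> norm (snd (g (p, X) - y)) \<le> \<nu> \<and>
        (\<forall>u. \<bar>inner l (G (p, X) (0, u))\<bar> \<le> 2 * \<eta> * norm u))"
proof -
  obtain d1 L where d1: "d1 > 0" and L: "L \<ge> 0" and d1S: "ball (pb, xb) d1 \<subseteq> S"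
    and lip: "\<And>z z'. z \<in> ball (pb, xb) d1 \<Longrightarrow> z' \<in> ball (pb, xb) d1 \<Longrightarrow> norm (g z - g z') \<le> L * norm (z - z')"
    using locally_lipschitz_at[OF S g_deriv isCont_G] by blast
  obtain K d2 where K: "K > 0" and d2: "d2 > 0" and
    calm: "\<And>p x. p \<in> P \<Longrightarrow> dist p pb < d2 \<Longrightarrow> dist x xb < d2 \<Longrightarrow>
      \<exists>\<xi>. snd (g (p, \<xi>)) \<in> C2 \<and> dist \<xi> x \<le> K * infdist (snd (g (p, x))) C2"
    using robinson_stable_approx[OF stable2 closed2 ne(2)] by blast
  \<comment> \<open>With \<open>p\<close> within \<open>\<delta>\<close> of \<open>pb\<close> and
    \<open>\<xi>\<close> within \<open>2 * \<delta>\<close> of \<open>xb\<close>, the pair is within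
    \<open>3 * \<delta> < d1\<close> of the base point.\<close>
  define \<delta> where "\<delta> = min d1 d2 / 4"
  have \<delta>: "\<delta> > 0" "4 * \<delta> \<le> d1" "4 * \<delta> \<le> d2" using d1 d2 by (auto simp: \<delta>_def)
  \<comment> \<open>The first summand pays for the move to \<open>x0\<close>, where the residual in
    \<open>C1\<close> is at most \<open>(1 + L * K) * D\<close>, and for halving the radius; the
    second bounds \<open>snd l\<close>.\<close>
  define M where "M = 2 * (1 + L * K) + 2 * (L + 2) * K"
  have LK: "L * K \<ge> 0" using L K by simp
  have M: "M > 0" "2 * (1 + L * K) \<le> M" "2 * K \<le> M" "2 * (L + 2) * K \<le> M"
    using L K LK by (auto simp: M_def algebra_simps add_pos_nonneg)
  show ?thesis
  proof (rule exI[of _ \<delta>], rule conjI, goal_cases)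
    case 1 then show ?case by (rule \<delta>(1))
  next
    case 2
    show ?case
    proof (rule exI[of _ M], intro conjI allI impI)
    fix p x r \<eta> \<nu> assume p: "p \<in> P" "dist p pb < \<delta>" and x: "dist x xb < \<delta>" and r: "0 < r" "r < \<delta>"
      and eta: "0 < \<eta>" "\<eta> < (1::real)" and nu: "0 < (\<nu>::real)"
      and MD: "M * infdist (g (p, x)) (C1 \<times> C2) \<le> \<eta>\<^sup>2 * r"
      and infeas: "\<forall>\<xi>. dist \<xi> x < r \<longrightarrow> g (p, \<xi>) \<notin> C1 \<times> C2"
    define D where "D = infdist (g (p, x)) (C1 \<times> C2)"
    have D0: "D \<ge> 0" by (simp add: D_def infdist_nonneg)
    have eta2: "\<eta>\<^sup>2 \<le> \<eta>" "\<eta>\<^sup>2 < 1"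
      using eta mult_left_mono[of \<eta> 1 \<eta>] by (auto simp: power2_eq_square intro: le_less_trans[of _ \<eta>])
    have KD: "K * D \<le> \<eta>\<^sup>2 * r / 2" "(1 + L * K) * D \<le> \<eta>\<^sup>2 * (r / 2)"
      using MD mult_right_mono[OF M(3) D0] mult_right_mono[OF M(2) D0]
      by (auto simp: D_def[symmetric] algebra_simps)
    have KD2: "K * D < r / 2" "K * D \<le> \<eta> * r / 2"
      using KD(1) mult_strict_right_mono[OF eta2(2) r(1)] mult_right_mono[OF eta2(1) less_imp_le[OF r(1)]]
      by linarith+
    obtain x0 where x0: "snd (g (p, x0)) \<in> C2" "dist x0 x \<le> K * infdist (snd (g (p, x))) C2"
      using calm[of p x] p x \<delta> by auto
    have x0x: "dist x0 x \<le> K * D"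
      using order_trans[OF x0(2)] infdist_Times_ge(2)[OF closed1 closed2 ne, of "g (p, x)"] K
      by (simp add: D_def)
    \<comment> \<open>As \<open>x0\<close> is closer to \<open>x\<close> than \<open>r / 2\<close>,
      the small ball about \<open>x0\<close> lies in the ball about \<open>x\<close> that contains
      no solution.\<close>
    have near: "dist \<xi> x < r" "dist \<xi> xb < 2 * \<delta>" "(p, \<xi>) \<in> ball (pb, xb) d1" if "\<xi> \<in> cball x0 (r / 2)" for \<xi>
    proof -
      show 1: "dist \<xi> x < r"
        using that x0x KD2 dist_triangle[of \<xi> x x0] by (simp add: dist_commute)
      then show 2: "dist \<xi> xb < 2 * \<delta>" using dist_triangle[of \<xi> xb x] r x by simp
      have "dist (p, \<xi>) (pb, xb) \<le> dist p pb + dist \<xi> xb"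
        by (simp add: dist_Pair_Pair sqrt_sum_squares_le_sum)
      then show "(p, \<xi>) \<in> ball (pb, xb) d1" using 2 p \<delta> by (simp add: dist_commute)
    qed
    have der: "((\<lambda>x. g (p, x)) has_derivative (\<lambda>u. G (p, \<xi>) (0, u))) (at \<xi>)" if "\<xi> \<in> cball x0 (r / 2)" for \<xi>
    proof -
      have pS: "(p, \<xi>) \<in> S" using near(3)[OF that] d1S by blast
      have "((\<lambda>x. (p, x)) has_derivative (\<lambda>u. (0, u))) (at \<xi>)"
        by (intro has_derivative_Pair has_derivative_const has_derivative_ident)
      from has_derivative_compose[OF this g_deriv[OF pS]] show ?thesis .
    qed
    have lip1: "norm (fst (g (p, \<xi>)) - fst (g (p, \<xi>'))) \<le> L * norm (\<xi> - \<xi>')"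
      if "(p, \<xi>) \<in> ball (pb, xb) d1" "(p, \<xi>') \<in> ball (pb, xb) d1" for \<xi> \<xi>'
      using lip[OF that] dist_fst_le[of "g (p, \<xi>)" "g (p, \<xi>')"] by (simp add: dist_norm)
    have start: "infdist (fst (g (p, x0))) C1 \<le> \<eta>\<^sup>2 * (r / 2)"
    proof -
      have "dist (p, x) (pb, xb) \<le> dist p pb + dist x xb"
        by (simp add: dist_Pair_Pair sqrt_sum_squares_le_sum)
      then have "(p, x) \<in> ball (pb, xb) d1" using p x \<delta> by (simp add: dist_commute)
      then have "norm (fst (g (p, x0)) - fst (g (p, x))) \<le> L * norm (x0 - x)"
        using near(3)[of x0] r by (intro lip1) auto
      also have "\<dots> \<le> L * (K * D)" using x0x L by (intro mult_left_mono) (auto simp: dist_norm)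
      finally have "infdist (fst (g (p, x0))) C1 \<le> D + L * (K * D)"
        using infdist_triangle[of "fst (g (p, x0))" C1 "fst (g (p, x))"]
          infdist_Times_ge(1)[OF closed1 closed2 ne, of "g (p, x)"]
        by (simp add: dist_norm D_def)
      then show ?thesis using KD(2) by (simp add: algebra_simps)
    qed
    have infeas': "\<not> (fst (g (p, \<xi>)) \<in> C1 \<and> snd (g (p, \<xi>)) \<in> C2)" if "\<xi> \<in> cball x0 (r / 2)" for \<xi>
      using infeas near(1)[OF that] by (simp add: mem_Times_iff)
    have calm': "\<exists>\<zeta>. snd (g (p, \<zeta>)) \<in> C2 \<and> dist \<zeta> \<xi> \<le> K * infdist (snd (g (p, \<xi>))) C2"
      if "\<xi> \<in> cball x0 (r / 2)" for \<xi>
      using near(2)[OF that] p \<delta> by (intro calm) auto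
    have r2: "0 < r / 2" using r by simp
    obtain X y1 y2 l1 l2 where X: "dist X x0 \<le> \<eta> * (r / 2)" "y1 \<in> C1" "y2 \<in> C2"
      "norm l1 = 1" "norm l2 \<le> 2 * (L + 2) * K"
      "l1 \<in> regular_normal_cone C1 y1" "l2 \<in> regular_normal_cone C2 y2"
      "fst (g (p, X)) - y1 = norm (fst (g (p, X)) - y1) *\<^sub>R l1"
      "norm (fst (g (p, X)) - y1) \<le> \<eta>\<^sup>2 * (r / 2)" "norm (snd (g (p, X)) - y2) \<le> \<nu>"
      "\<And>u. \<bar>inner l1 (fst (G (p, X) (0, u))) + inner l2 (snd (G (p, X) (0, u)))\<bar> \<le> 2 * \<eta> * norm u"
      using approximate_multipliers[where ?f1.0 = "\<lambda>x. fst (g (p, x))" and ?f2.0 = "\<lambda>x. snd (g (p, x))",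
          OF closed1 ne(1) closed2 r2 eta x0(1) start infeas' has_derivative_fst[OF der] has_derivative_snd[OF der]
            lip1[OF near(3) near(3)] L calm' K nu]
      by blast
    show "\<exists>X y l. dist X x \<le> \<eta> * r \<and> y \<in> C1 \<times> C2 \<and> norm (fst l) = 1 \<and> norm (snd l) \<le> M \<and>
        l \<in> regular_normal_cone (C1 \<times> C2) y \<and>
        (\<exists>c\<ge>0. fst (g (p, X)) - fst y = c *\<^sub>R fst l) \<and>
        norm (g (p, X) - y) \<le> \<eta>\<^sup>2 * r + \<nu> \<and> norm (snd (g (p, X) - y)) \<le> \<nu> \<and>
        (\<forall>u. \<bar>inner l (G (p, X) (0, u))\<bar> \<le> 2 * \<eta> * norm u)"
    proof (rule exI[of _ X], rule exI[of _ "(y1, y2)"], rule exI[of _ "(l1, l2)"], intro conjI)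
      show "dist X x \<le> \<eta> * r"
        using X(1) x0x KD2(2) dist_triangle[of X x x0] by simp
      show "norm (snd (l1, l2)) \<le> M" using X(5) M(4) by simp
      show "(l1, l2) \<in> regular_normal_cone (C1 \<times> C2) (y1, y2)"
        using X by (intro regular_normal_cone_Times)
      show "\<exists>c\<ge>0. fst (g (p, X)) - fst (y1, y2) = c *\<^sub>R fst (l1, l2)"
        using X(8) by (metis fst_conv norm_ge_zero)
      have "norm (g (p, X) - (y1, y2)) \<le> norm (fst (g (p, X)) - y1) + norm (snd (g (p, X)) - y2)"
        by (simp add: norm_prod_def sqrt_sum_squares_le_sum)
      moreover have "\<eta>\<^sup>2 * (r / 2) \<le> \<eta>\<^sup>2 * r" using r by (intro mult_left_mono) auto
      ultimately show "norm (g (p, X) - (y1, y2)) \<le> \<eta>\<^sup>2 * r + \<nu>"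
        using X(9,10) by linarith
      show "\<forall>u. \<bar>inner (l1, l2) (G (p, X) (0, u))\<bar> \<le> 2 * \<eta> * norm u"
        using X(11) by (simp add: inner_prod_def)
    qed (use X in auto)
    qed (use M in auto)
  qed
qed

section \<open>Contradiction along a direction\<close>

text \<open>Since \<open>r k\<close> is at most proportional to \<open>t k\<close>, the shift from
  \<open>x k\<close> to the minimiser is of smaller order than \<open>t k\<close> and the direction
  \<open>(w, u)\<close> survives. The limit \<open>lam\<close> of the multipliers meets every
  premise of \<open>second_order\<close>, which forces \<open>fst lam = 0\<close> although its norm
  is 1.\<close>

lemma no_directional_infeasibility:
  fixes t r :: "nat \<Rightarrow> real"
  assumes t: "\<And>k. t k > 0" "t \<longlonglongrightarrow> 0"
    and pP: "\<And>k. p k \<in> P"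
    and w: "(\<lambda>k. (1 / t k) *\<^sub>R (p k - pb)) \<longlonglongrightarrow> w" and u: "(\<lambda>k. (1 / t k) *\<^sub>R (x k - xb)) \<longlonglongrightarrow> u"
    and nz: "(w, u) \<noteq> (0, 0)"
    and r: "\<And>k. r k > 0" "\<And>k. r k \<le> B * t k"
    and d: "(\<lambda>k. infdist (g (p k, x k)) (C1 \<times> C2) / r k) \<longlonglongrightarrow> 0"
    and infeas: "\<And>k \<xi>. dist \<xi> (x k) < r k \<Longrightarrow> g (p k, \<xi>) \<notin> C1 \<times> C2"
  shows False
proof -
  obtain \<delta> M where \<delta>: "\<delta> > 0" and M: "M > 0" and step:
    "\<And>p x r \<eta> \<nu>. p \<in> P \<Longrightarrow> dist p pb < \<delta> \<Longrightarrow> dist x xb < \<delta> \<Longrightarrow> 0 < r \<Longrightarrow> r < \<delta> \<Longrightarrow>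
     0 < \<eta> \<Longrightarrow> \<eta> < 1 \<Longrightarrow> 0 < \<nu> \<Longrightarrow> M * infdist (g (p, x)) (C1 \<times> C2) \<le> \<eta>\<^sup>2 * r \<Longrightarrow>
     (\<forall>\<xi>. dist \<xi> x < r \<longrightarrow> g (p, \<xi>) \<notin> C1 \<times> C2) \<Longrightarrow>
     (\<exists>X y l. dist X x \<le> \<eta> * r \<and> y \<in> C1 \<times> C2 \<and> norm (fst l) = 1 \<and> norm (snd l) \<le> M \<and>
        l \<in> regular_normal_cone (C1 \<times> C2) y \<and>
        (\<exists>c\<ge>0. fst (g (p, X)) - fst y = c *\<^sub>R fst l) \<and>
        norm (g (p, X) - y) \<le> \<eta>\<^sup>2 * r + \<nu> \<and> norm (snd (g (p, X) - y)) \<le> \<nu> \<and>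
        (\<forall>u. \<bar>inner l (G (p, X) (0, u))\<bar> \<le> 2 * \<eta> * norm u))"
    using multipliers_near_infeasible_point by blast
  define D where "D k = infdist (g (p k, x k)) (C1 \<times> C2)" for k
  have Dpos: "D k > 0" for k
    unfolding D_def using infeas[of "x k" k] r(1)[of k] closed_C feas
    by (intro infdist_pos_not_in_closed) auto
  \<comment> \<open>Chosen so that the residual hypothesis of \<open>step\<close> holds with
    equality; it tends to 0 because \<open>D k / r k\<close> does.\<close>
  define \<eta> where "\<eta> k = sqrt (M * (D k / r k))" for k
  have eta_pos: "\<eta> k > 0" for k using Dpos[of k] M r(1)[of k] by (simp add: \<eta>_def)
  have eta_sq: "(\<eta> k)\<^sup>2 * r k = M * D k" for k
    using Dpos[of k] M r(1)[of k] by (simp add: \<eta>_def)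
  have eta0: "\<eta> \<longlonglongrightarrow> 0"
  proof -
    have "(\<lambda>k. sqrt (M * (D k / r k))) \<longlonglongrightarrow> sqrt (M * 0)"
      using d unfolding D_def by (intro tendsto_intros)
    then show ?thesis by (simp add: \<eta>_def[abs_def])
  qed
  have tends: "a \<longlonglongrightarrow> a0" if "(\<lambda>k. (1 / t k) *\<^sub>R (a k - a0)) \<longlonglongrightarrow> b"
    for a :: "nat \<Rightarrow> 'z::real_normed_vector" and a0 b
  proof -
    have "(\<lambda>k. t k *\<^sub>R ((1 / t k) *\<^sub>R (a k - a0))) \<longlonglongrightarrow> 0 *\<^sub>R b"
      using t(2) that by (rule tendsto_scaleR)
    then have "(\<lambda>k. a k - a0) \<longlonglongrightarrow> 0" using t(1) by (simp add: less_imp_neq[symmetric])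
    then show ?thesis by (simp add: LIM_zero_iff)
  qed
  have p_lim: "p \<longlonglongrightarrow> pb" and x_lim: "x \<longlonglongrightarrow> xb" using tends w u by blast+
  have r0: "r \<longlonglongrightarrow> 0"
  proof (rule tendsto_sandwich[OF _ _ tendsto_const])
    show "(\<lambda>k. B * t k) \<longlonglongrightarrow> 0" using tendsto_mult_right_zero[OF t(2)] .
  qed (use r in \<open>auto intro: always_eventually less_imp_le\<close>)
  \<comment> \<open>The tolerance \<open>(t k)^3\<close> makes the residual in the second block \<open>o((t k)\<^sup>2)\<close>, hence negligible at
    second order; the residual in the first block only needs the right sign.\<close>
  define Q where "Q k X y l \<longleftrightarrow> dist X (x k) \<le> \<eta> k * r k \<and> y \<in> C1 \<times> C2 \<and> norm (fst l) = 1 \<and>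
        norm (snd l) \<le> M \<and> l \<in> regular_normal_cone (C1 \<times> C2) y \<and>
        (\<exists>c\<ge>0. fst (g (p k, X)) - fst y = c *\<^sub>R fst l) \<and>
        norm (g (p k, X) - y) \<le> (\<eta> k)\<^sup>2 * r k + (t k)^3 \<and> norm (snd (g (p k, X) - y)) \<le> (t k)^3 \<and>
        (\<forall>u. \<bar>inner l (G (p k, X) (0, u))\<bar> \<le> 2 * \<eta> k * norm u)" for k X y l
  have "\<forall>\<^sub>F k in sequentially. \<exists>X y l. Q k X y l"
  proof -
    have "\<forall>\<^sub>F k in sequentially. dist (p k) pb < \<delta>" "\<forall>\<^sub>F k in sequentially. dist (x k) xb < \<delta>"
      using p_lim x_lim \<delta> by (auto dest: tendstoD)
    moreover have "\<forall>\<^sub>F k in sequentially. r k < \<delta>" using r0 \<delta> by (rule order_tendstoD)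
    moreover have "\<forall>\<^sub>F k in sequentially. \<eta> k < 1" using eta0 by (rule order_tendstoD) simp
    ultimately show ?thesis
    proof eventually_elim
      case (elim k)
      show ?case
        unfolding Q_def
        by (rule step) (use elim pP r eta_pos t eta_sq infeas in \<open>auto simp: D_def\<close>)
    qed
  qed
  then obtain N where "\<And>k. k \<ge> N \<Longrightarrow> \<exists>X y l. Q k X y l" unfolding eventually_sequentially by blast
  then have "\<forall>k. \<exists>X y l. Q (k + N) X y l" by simp
  then obtain X0 y0 l0 where Q0: "\<And>k. Q (k + N) (X0 k) (y0 k) (l0 k)" by metis
  have "norm (l0 k) \<le> 1 + M" for k
    using Q0[of k] norm_Pair_le[of "fst (l0 k)" "snd (l0 k)"] unfolding Q_def by simp
  then have "\<forall>k. l0 k \<in> cball 0 (1 + M)" by simp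
  then obtain lam \<sigma> where \<sigma>: "strict_mono \<sigma>" and lam: "(l0 \<circ> \<sigma>) \<longlonglongrightarrow> lam"
    using compact_cball[unfolded compact_def, rule_format] by blast
  \<comment> \<open>\<open>l0 k\<close> belongs to the index \<open>k + N\<close>, so the convergent
    subsequence corresponds to the indices \<open>\<sigma> k + N\<close>.\<close>
  define s where "s k = \<sigma> k + N" for k
  have s: "strict_mono s" using \<sigma> by (simp add: s_def strict_mono_def)
  define X y l where "X = X0 \<circ> \<sigma>" and "y = y0 \<circ> \<sigma>" and "l = l0 \<circ> \<sigma>"
  have QQ: "Q (s k) (X k) (y k) (l k)" for k using Q0[of "\<sigma> k"] by (simp add: s_def X_def y_def l_def)
  have l_lim: "l \<longlonglongrightarrow> lam" using lam by (simp add: l_def)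
  define \<tau> where "\<tau> k = t (s k)" for k
  have sub: "(\<lambda>k. a (s k)) \<longlonglongrightarrow> b" if "a \<longlonglongrightarrow> b" for a :: "nat \<Rightarrow> 'z::topological_space" and b
    using LIMSEQ_subseq_LIMSEQ[OF that s] by (simp add: comp_def)
  have tau: "\<tau> k > 0" for k using t by (simp add: \<tau>_def)
  have tau0: "\<tau> \<longlonglongrightarrow> 0" using sub[OF t(2)] by (simp add: \<tau>_def[abs_def])
  have eta0': "(\<lambda>k. \<eta> (s k)) \<longlonglongrightarrow> 0" using sub[OF eta0] .
  have rB: "r (s k) / \<tau> k \<le> B" for k using r(2)[of "s k"] tau[of k] by (simp add: \<tau>_def field_simps)
  define wk where "wk k = (1 / \<tau> k) *\<^sub>R (p (s k) - pb)" for k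
  define uk where "uk k = (1 / \<tau> k) *\<^sub>R (X k - xb)" for k
  have wk: "wk \<longlonglongrightarrow> w" using sub[OF w] by (simp add: wk_def[abs_def] \<tau>_def)
  \<comment> \<open>\<open>X k\<close> lies within \<open>\<eta> (s k) * r (s k)\<close> of
    \<open>x (s k)\<close>, hence within \<open>\<eta> (s k) * B * \<tau> k\<close>, which vanishes
    after division by \<open>\<tau> k\<close>.\<close>
  have uk: "uk \<longlonglongrightarrow> u"
  proof -
    have "(\<lambda>k. (1 / \<tau> k) *\<^sub>R (X k - x (s k))) \<longlonglongrightarrow> 0"
    proof (rule Lim_null_comparison[OF always_eventually])
      show "\<forall>k. norm ((1 / \<tau> k) *\<^sub>R (X k - x (s k))) \<le> \<eta> (s k) * B"
      proof
        fix k
        have "norm (X k - x (s k)) / \<tau> k \<le> \<eta> (s k) * r (s k) / \<tau> k"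
          using QQ[of k] tau[of k] unfolding Q_def by (intro divide_right_mono) (auto simp: dist_norm)
        also have "\<dots> \<le> \<eta> (s k) * B"
          using mult_left_mono[OF rB[of k], of "\<eta> (s k)"] eta_pos[of "s k"] by simp
        finally show "norm ((1 / \<tau> k) *\<^sub>R (X k - x (s k))) \<le> \<eta> (s k) * B"
          using tau[of k] by simp
      qed
      show "(\<lambda>k. \<eta> (s k) * B) \<longlonglongrightarrow> 0" using tendsto_mult_left_zero[OF eta0'] .
    qed
    from tendsto_add[OF this sub[OF u]] show ?thesis
      by (simp add: uk_def[abs_def] \<tau>_def scaleR_right_diff_distrib)
  qed
  define h where "h k = (wk k, uk k)" for k
  define zb where "zb = (pb, xb)"
  define yb where "yb = g zb"
  define h0 where "h0 = (w, u)"
  define v0 where "v0 = G zb h0"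
  have h: "h \<longlonglongrightarrow> h0" unfolding h_def[abs_def] h0_def by (intro tendsto_intros wk uk)
  have z: "zb + \<tau> k *\<^sub>R h k = (p (s k), X k)" for k
    using tau[of k] by (simp add: zb_def h_def wk_def uk_def)
  have wP: "pb + \<tau> k *\<^sub>R wk k \<in> P" for k using pP tau[of k] by (simp add: wk_def)
  define q where "q k = (1 / (\<tau> k)\<^sup>2) *\<^sub>R (g (p (s k), X k) - yb - \<tau> k *\<^sub>R G zb (h k))" for k
  have q: "q \<longlonglongrightarrow> (1/2) *\<^sub>R G2 h0 h0"
    using second_order_quotient_tendsto[OF S g_deriv G_deriv tau tau0 h]
    unfolding q_def[abs_def] yb_def zb_def[symmetric] z .
  define e where "e k = g (p (s k), X k) - y k" for k
  \<comment> \<open>Scaled so that \<open>y k = yb + \<tau> k *\<^sub>R v k\<close>: the directions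
    along which the base points of the normals approach \<open>yb\<close>.\<close>
  define v where "v k = (1 / \<tau> k) *\<^sub>R (y k - yb)" for k
  have v_eq: "v k = \<tau> k *\<^sub>R q k + G zb (h k) - (1 / \<tau> k) *\<^sub>R e k" for k
    using tau[of k] by (simp add: v_def q_def e_def power2_eq_square algebra_simps)
  \<comment> \<open>The residual is only of smaller order than \<open>\<tau> k\<close>, enough for
    \<open>v\<close> to converge to \<open>v0\<close>; at second order its sign is used instead, in
    \<open>err\<close>.\<close>
  have e0: "(\<lambda>k. (1 / \<tau> k) *\<^sub>R e k) \<longlonglongrightarrow> 0"
  proof (rule Lim_null_comparison[OF always_eventually])
    show "\<forall>k. norm ((1 / \<tau> k) *\<^sub>R e k) \<le> (\<eta> (s k))\<^sup>2 * B + (\<tau> k)\<^sup>2"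
    proof
      fix k
      have "norm (e k) / \<tau> k \<le> ((\<eta> (s k))\<^sup>2 * r (s k) + (\<tau> k)^3) / \<tau> k"
        using QQ[of k] tau[of k] unfolding Q_def e_def by (intro divide_right_mono) (auto simp: \<tau>_def)
      also have "\<dots> = (\<eta> (s k))\<^sup>2 * (r (s k) / \<tau> k) + (\<tau> k)\<^sup>2"
        using tau[of k] by (simp add: add_divide_distrib power2_eq_square power3_eq_cube)
      also have "\<dots> \<le> (\<eta> (s k))\<^sup>2 * B + (\<tau> k)\<^sup>2"
        using rB[of k] by (intro add_mono mult_left_mono) auto
      finally show "norm ((1 / \<tau> k) *\<^sub>R e k) \<le> (\<eta> (s k))\<^sup>2 * B + (\<tau> k)\<^sup>2"
        using tau[of k] by simp
    qed
    have "(\<lambda>k. (\<eta> (s k))\<^sup>2 * B + (\<tau> k)\<^sup>2) \<longlonglongrightarrow> 0\<^sup>2 * B + 0\<^sup>2"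
      by (intro tendsto_intros eta0' tau0)
    then show "(\<lambda>k. (\<eta> (s k))\<^sup>2 * B + (\<tau> k)\<^sup>2) \<longlonglongrightarrow> 0" by simp
  qed
  have v: "v \<longlonglongrightarrow> v0"
  proof -
    have "(\<lambda>k. \<tau> k *\<^sub>R q k + G zb (h k) - (1 / \<tau> k) *\<^sub>R e k) \<longlonglongrightarrow> 0 *\<^sub>R ((1/2) *\<^sub>R G2 h0 h0) + G zb h0 - 0"
      by (intro tendsto_intros tau0 q h e0)
    then show ?thesis by (simp add: v_eq[abs_def] v0_def)
  qed
  have yv: "yb + \<tau> k *\<^sub>R v k = y k" for k using tau[of k] by (simp add: v_def)
  have yC: "y k \<in> C1 \<times> C2" and lN: "l k \<in> regular_normal_cone (C1 \<times> C2) (y k)"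
    and l1: "norm (fst (l k)) = 1" for k
    using QQ[of k] unfolding Q_def by blast+
  have lam1: "norm (fst lam) = 1"
    using tendsto_norm[OF tendsto_fst[OF l_lim]] l1 by (simp add: LIMSEQ_const_iff)
  have lam_x: "inner lam (G zb (0, u')) = 0" for u'
  proof -
    have "(\<lambda>k. (p (s k), X k)) \<longlonglongrightarrow> zb"
    proof -
      have "(\<lambda>k. zb + \<tau> k *\<^sub>R h k) \<longlonglongrightarrow> zb + 0 *\<^sub>R h0" by (intro tendsto_intros tau0 h)
      then show ?thesis by (simp add: z)
    qed
    then have "(\<lambda>k. G (p (s k), X k)) \<longlonglongrightarrow> G zb"
      using isCont_G unfolding zb_def by (rule isCont_tendsto_compose[rotated])
    then have lim: "(\<lambda>k. inner (l k) (G (p (s k), X k) (0, u'))) \<longlonglongrightarrow> inner lam (G zb (0, u'))"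
      by (intro tendsto_intros l_lim)
    have "(\<lambda>k. inner (l k) (G (p (s k), X k) (0, u'))) \<longlonglongrightarrow> 0"
    proof (rule Lim_null_comparison[OF always_eventually])
      show "\<forall>k. norm (inner (l k) (G (p (s k), X k) (0, u'))) \<le> 2 * \<eta> (s k) * norm u'"
        using QQ unfolding Q_def real_norm_def by blast
      have "(\<lambda>k. 2 * \<eta> (s k) * norm u') \<longlonglongrightarrow> 2 * 0 * norm u'" by (intro tendsto_intros eta0')
      then show "(\<lambda>k. 2 * \<eta> (s k) * norm u') \<longlonglongrightarrow> 0" by simp
    qed
    from LIMSEQ_unique[OF lim this] show ?thesis .
  qed
  define adj where "adj = adjoint (\<lambda>w'. blinfun_apply (G zb) (w', 0)) lam"
  have adj: "inner adj w' = inner lam (G zb (w', 0))" for w'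
  proof -
    have "linear (\<lambda>w'. blinfun_apply (G zb) (w', 0))"
      by (rule linearI) (simp_all flip: blinfun.add_right blinfun.scaleR_right)
    from adjoint_works[OF this, of w' lam] show ?thesis by (simp add: adj_def inner_commute)
  qed
  \<comment> \<open>The first block of \<open>e k\<close> is a nonnegative multiple of
    \<open>fst (l k)\<close>, whose inner product with its limit \<open>fst lam\<close> is
    eventually positive. It thus has a favourable sign, and only the second block, of size at most
    \<open>(\<tau> k)^3\<close>, enters the bound.\<close>
  have err: "\<forall>\<^sub>F k in sequentially. - inner lam (e k) \<le> norm (snd lam) * (\<tau> k)^3"
  proof -
    have "(\<lambda>k. inner (fst lam) (fst (l k))) \<longlonglongrightarrow> inner (fst lam) (fst lam)"
      by (intro tendsto_intros l_lim)
    moreover have "inner (fst lam) (fst lam) > 0" using lam1 by (auto simp: inner_gt_zero_iff)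
    ultimately have "\<forall>\<^sub>F k in sequentially. inner (fst lam) (fst (l k)) > 0" by (rule order_tendstoD)
    then show ?thesis
    proof eventually_elim
      case (elim k)
      obtain c where c: "c \<ge> 0" "fst (e k) = c *\<^sub>R fst (l k)"
        using QQ[of k] unfolding Q_def e_def by auto
      have "inner (fst lam) (fst (e k)) \<ge> 0" using c elim by simp
      moreover have "- inner (snd lam) (snd (e k)) \<le> norm (snd lam) * (\<tau> k)^3"
      proof -
        have "- inner (snd lam) (snd (e k)) \<le> norm (snd lam) * norm (snd (e k))"
          using Cauchy_Schwarz_ineq2[of "snd lam" "snd (e k)"] by linarith
        also have "\<dots> \<le> norm (snd lam) * (\<tau> k)^3"
          using QQ[of k] unfolding Q_def e_def by (intro mult_left_mono) (auto simp: \<tau>_def)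
        finally show ?thesis .
      qed
      ultimately show ?case by (simp add: inner_prod_def)
    qed
  qed
  \<comment> \<open>The finite part of the curvature inequality: half of the Hessian form in the
    limit, plus a vanishing contribution of the second residual.\<close>
  define a where "a k = inner lam (q k) + norm (snd lam) * \<tau> k" for k
  have a: "a \<longlonglongrightarrow> inner lam (G2 h0 h0) / 2"
  proof -
    have "(\<lambda>k. inner lam (q k) + norm (snd lam) * \<tau> k)
        \<longlonglongrightarrow> inner lam ((1/2) *\<^sub>R G2 h0 h0) + norm (snd lam) * 0"
      by (intro tendsto_intros q tau0)
    then show ?thesis by (simp add: a_def[abs_def])
  qed
  have le: "\<forall>\<^sub>F k in sequentially. inner lam (v k - v0) / \<tau> k \<le> inner adj (wk k - w) / \<tau> k + a k"
    using err
  proof eventually_elim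
    case (elim k)
    \<comment> \<open>\<open>lam\<close> annihilates the partial derivative in \<open>x\<close>, so
      only the \<open>p\<close> part of \<open>h k - h0\<close> remains, expressed through
      \<open>adj\<close>.\<close>
    have "G zb (h k) - v0 = G zb (wk k - w, 0) + G zb (0, uk k - u)"
      by (simp add: v0_def h_def h0_def flip: blinfun.diff_right blinfun.add_right)
    then have "inner lam (G zb (h k) - v0) = inner adj (wk k - w)"
      by (simp add: inner_add_right lam_x adj)
    moreover have "v k - v0 = \<tau> k *\<^sub>R q k + (G zb (h k) - v0) - (1 / \<tau> k) *\<^sub>R e k"
      by (simp add: v_eq)
    ultimately have "inner lam (v k - v0) = \<tau> k * inner lam (q k) + inner adj (wk k - w) - inner lam (e k) / \<tau> k"
      by (simp add: inner_add_right inner_diff_right)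
    also have "\<dots> \<le> \<tau> k * inner lam (q k) + inner adj (wk k - w) + norm (snd lam) * (\<tau> k)\<^sup>2"
    proof -
      have "- inner lam (e k) / \<tau> k \<le> norm (snd lam) * (\<tau> k)^3 / \<tau> k"
        using elim tau[of k] by (intro divide_right_mono) auto
      also have "\<dots> = norm (snd lam) * (\<tau> k)\<^sup>2" using tau[of k] by (simp add: power2_eq_square power3_eq_cube)
      finally show ?thesis by simp
    qed
    finally have "inner lam (v k - v0) / \<tau> k
        \<le> (\<tau> k * inner lam (q k) + inner adj (wk k - w) + norm (snd lam) * (\<tau> k)\<^sup>2) / \<tau> k"
      using tau[of k] by (intro divide_right_mono) auto
    also have "\<dots> = inner adj (wk k - w) / \<tau> k + a k"
      using tau[of k] by (simp add: a_def add_divide_distrib power2_eq_square)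
    finally show ?case .
  qed
  have "lower_curvature (C1 \<times> C2) lam yb v0
      \<le> ereal (inner lam (G2 h0 h0) / 2) + upper_curvature P adj pb w"
  proof (rule curvature_comparison[OF tau tau0 wP wk v _ l_lim le a])
    show "l k \<in> limiting_normal_cone (C1 \<times> C2) (yb + \<tau> k *\<^sub>R v k)" for k
      unfolding yv using lN by (rule regular_imp_limiting_normal)
  qed
  moreover have "w \<in> tangent_cone P pb"
    unfolding tangent_cone_def using tau tau0 wk wP by blast
  moreover have "v0 \<in> tangent_cone (C1 \<times> C2) yb"
    unfolding tangent_cone_def using tau tau0 v yC yv by (intro CollectI exI[of _ \<tau>] exI[of _ v]) simp
  moreover have "lam \<in> dir_limiting_normal_cone (C1 \<times> C2) yb v0"
    unfolding dir_limiting_normal_cone_def using tau tau0 v yC lN yv l_lim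
    by (intro CollectI exI[of _ \<tau>] exI[of _ v] exI[of _ l]) simp
  ultimately have "fst lam = 0"
    using second_order[OF nz, of lam] lam_x unfolding adj_def yb_def v0_def h0_def zb_def by blast
  with lam1 show False by simp
qed

text \<open>Along a direction, \<open>r k\<close> may be taken much smaller than \<open>t k\<close>: only an infeasibility that is small
  compared with \<open>r k\<close> is required.\<close>

lemma eventually_feasible_nearby:
  fixes t r :: "nat \<Rightarrow> real"
  assumes t: "\<And>k. t k > 0" "t \<longlonglongrightarrow> 0"
    and pP: "\<And>k. p k \<in> P"
    and w: "(\<lambda>k. (1 / t k) *\<^sub>R (p k - pb)) \<longlonglongrightarrow> w" and u: "(\<lambda>k. (1 / t k) *\<^sub>R (x k - xb)) \<longlonglongrightarrow> u"
    and nz: "(w, u) \<noteq> (0, 0)"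
    and r: "\<And>k. r k > 0" "\<And>k. r k \<le> B * t k"
    and d: "(\<lambda>k. infdist (g (p k, x k)) (C1 \<times> C2) / r k) \<longlonglongrightarrow> 0"
  shows "\<forall>\<^sub>F k in sequentially. \<exists>\<xi>. dist \<xi> (x k) < r k \<and> g (p k, \<xi>) \<in> C1 \<times> C2"
proof (rule ccontr)
  assume "\<not> ?thesis"
  then have "\<exists>\<^sub>F k in sequentially. \<not> (\<exists>\<xi>. dist \<xi> (x k) < r k \<and> g (p k, \<xi>) \<in> C1 \<times> C2)"
    by (simp add: not_eventually)
  \<comment> \<open>Infinitely many indices fail; the contradiction is drawn along the subsequence
    that enumerates them.\<close>
  then have inf: "infinite {k. \<not> (\<exists>\<xi>. dist \<xi> (x k) < r k \<and> g (p k, \<xi>) \<in> C1 \<times> C2)}"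
    by (simp add: frequently_cofinite flip: cofinite_eq_sequentially)
  obtain s :: "nat \<Rightarrow> nat" where s: "strict_mono s"
    "\<And>k. s k \<in> {k. \<not> (\<exists>\<xi>. dist \<xi> (x k) < r k \<and> g (p k, \<xi>) \<in> C1 \<times> C2)}"
    using infinite_enumerate[OF inf] by blast
  show False
  proof (rule no_directional_infeasibility[of "t \<circ> s" "p \<circ> s" w "x \<circ> s" u "r \<circ> s" B])
    show "(t \<circ> s) \<longlonglongrightarrow> 0" by (rule LIMSEQ_subseq_LIMSEQ[OF t(2) s(1)])
    show "(\<lambda>k. (1 / (t \<circ> s) k) *\<^sub>R ((p \<circ> s) k - pb)) \<longlonglongrightarrow> w"
      using LIMSEQ_subseq_LIMSEQ[OF w s(1)] by (simp add: comp_def)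
    show "(\<lambda>k. (1 / (t \<circ> s) k) *\<^sub>R ((x \<circ> s) k - xb)) \<longlonglongrightarrow> u"
      using LIMSEQ_subseq_LIMSEQ[OF u s(1)] by (simp add: comp_def)
    show "(\<lambda>k. infdist (g ((p \<circ> s) k, (x \<circ> s) k)) (C1 \<times> C2) / (r \<circ> s) k) \<longlonglongrightarrow> 0"
      using LIMSEQ_subseq_LIMSEQ[OF d s(1)] by (simp add: comp_def)
  qed (use t pP nz r s(2) in auto)
qed

section \<open>Linear bound on the distance to the solution set\<close>

text \<open>If \<open>p k = pb\<close> infinitely often, \<open>xb\<close> is a solution for these
  parameters. Otherwise \<open>p k - pb\<close>, normalised by its own length, has a limit direction
  \<open>w\<close>, for which \<open>directional\<close> gives \<open>u\<close>. The points
  \<open>xb + t k *\<^sub>R u\<close> have a residual of smaller order than \<open>t k\<close>, so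
  there are solutions within \<open>t k\<close> of them.\<close>

lemma feasible_at_linear_distance:
  assumes pP: "\<And>k. p k \<in> P" and p: "p \<longlonglongrightarrow> pb" and x: "x \<longlonglongrightarrow> xb"
    and directional: "\<And>w \<tau>. w \<in> tangent_cone P pb \<Longrightarrow> (\<And>k::nat. \<tau> k > 0) \<Longrightarrow> \<tau> \<longlonglongrightarrow> 0 \<Longrightarrow>
      \<exists>u. liminf (\<lambda>k. ereal (infdist (g (pb, xb) + \<tau> k *\<^sub>R G (pb, xb) (w, u)) (C1 \<times> C2) / \<tau> k)) = 0"
  shows "\<exists>\<sigma> B. strict_mono (\<sigma> :: nat \<Rightarrow> nat) \<and> (\<forall>k. \<exists>\<xi>. g (p (\<sigma> k), \<xi>) \<in> C1 \<times> C2 \<and>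
      dist \<xi> (x (\<sigma> k)) \<le> B * norm (p (\<sigma> k) - pb, x (\<sigma> k) - xb))"
proof (cases "infinite {k. p k = pb}")
  case True
  obtain s :: "nat \<Rightarrow> nat" where s: "strict_mono s" "\<And>k. s k \<in> {k. p k = pb}"
    using infinite_enumerate[OF True] by blast
  have "g (p (s k), xb) \<in> C1 \<times> C2 \<and> dist xb (x (s k)) \<le> 1 * norm (p (s k) - pb, x (s k) - xb)" for k
    using s(2)[of k] feas norm_snd_le[of "x (s k) - xb" "p (s k) - pb"]
    by (simp add: dist_norm norm_minus_commute)
  then show ?thesis using s(1) by blast
next
  case False
  then obtain N where N: "\<And>k. p k = pb \<Longrightarrow> k \<le> N" using finite_nat_set_iff_bounded_le by auto
  \<comment> \<open>Every index with \<open>p k = pb\<close> is at most \<open>N\<close>, so the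
    shift by \<open>Suc N\<close> makes \<open>\<tau>1\<close> positive throughout.\<close>
  define p1 where "p1 k = p (k + Suc N)" for k
  define \<tau>1 where "\<tau>1 k = norm (p1 k - pb)" for k
  have \<tau>1: "\<tau>1 k > 0" for k using N[of "k + Suc N"] by (auto simp: \<tau>1_def p1_def)
  have p1: "p1 \<longlonglongrightarrow> pb" unfolding p1_def[abs_def] by (rule LIMSEQ_ignore_initial_segment[OF p])
  have \<tau>10: "\<tau>1 \<longlonglongrightarrow> 0"
    unfolding \<tau>1_def[abs_def] using p1 by (intro tendsto_norm_zero) (simp add: LIM_zero_iff)
  have "\<forall>k. (1 / \<tau>1 k) *\<^sub>R (p1 k - pb) \<in> sphere 0 1"
    using \<tau>1 by (simp add: \<tau>1_def)
  from seq_compactE[OF compact_imp_seq_compact[OF compact_sphere] this]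
  obtain w s1 where w: "w \<in> sphere 0 1" and s1: "strict_mono (s1 :: nat \<Rightarrow> nat)"
    and w_lim: "((\<lambda>k. (1 / \<tau>1 k) *\<^sub>R (p1 k - pb)) \<circ> s1) \<longlonglongrightarrow> w"
    by blast
  define \<tau>2 where "\<tau>2 = \<tau>1 \<circ> s1"
  have \<tau>2: "\<tau>2 k > 0" for k using \<tau>1 by (simp add: \<tau>2_def)
  have \<tau>20: "\<tau>2 \<longlonglongrightarrow> 0" unfolding \<tau>2_def by (rule LIMSEQ_subseq_LIMSEQ[OF \<tau>10 s1])
  have p1P: "p1 k \<in> P" for k using pP by (simp add: p1_def)
  have "w \<in> tangent_cone P pb"
    unfolding tangent_cone_def
    using \<tau>2 \<tau>20 w_lim p1P \<tau>1
    by (intro CollectI exI[of _ \<tau>2] exI[of _ "(\<lambda>k. (1 / \<tau>1 k) *\<^sub>R (p1 k - pb)) \<circ> s1"])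
      (simp add: \<tau>2_def less_imp_neq[symmetric])
  from directional[OF this \<tau>2 \<tau>20] obtain u where
    u: "liminf (\<lambda>k. ereal (infdist (g (pb, xb) + \<tau>2 k *\<^sub>R G (pb, xb) (w, u)) (C1 \<times> C2) / \<tau>2 k)) = 0"
    by blast
  \<comment> \<open>\<open>directional\<close> controls only a lower limit; a further subsequence
    turns it into a limit.\<close>
  obtain s2 where s2: "strict_mono s2"
    and s2_lim: "((\<lambda>k. ereal (infdist (g (pb, xb) + \<tau>2 k *\<^sub>R G (pb, xb) (w, u)) (C1 \<times> C2) / \<tau>2 k)) \<circ> s2) \<longlonglongrightarrow> 0"
    using liminf_subseq_lim[of "\<lambda>k. ereal (infdist (g (pb, xb) + \<tau>2 k *\<^sub>R G (pb, xb) (w, u)) (C1 \<times> C2) / \<tau>2 k)"]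
    unfolding u by blast
  define t where "t k = \<tau>2 (s2 k)" for k
  have t: "t k > 0" for k using \<tau>2 by (simp add: t_def)
  have t0: "t \<longlonglongrightarrow> 0" using LIMSEQ_subseq_LIMSEQ[OF \<tau>20 s2] by (simp add: t_def[abs_def] comp_def)
  have lin: "(\<lambda>k. infdist (g (pb, xb) + t k *\<^sub>R G (pb, xb) (w, u)) (C1 \<times> C2) / t k) \<longlonglongrightarrow> 0"
    using s2_lim[unfolded comp_def zero_ereal_def lim_ereal] by (simp add: t_def)
  define p2 where "p2 k = p1 (s1 (s2 k))" for k
  have t_eq: "t k = norm (p2 k - pb)" for k by (simp add: t_def \<tau>2_def \<tau>1_def p2_def)
  have p2P: "p2 k \<in> P" for k using p1P by (simp add: p2_def)
  have w_lim2: "(\<lambda>k. (1 / t k) *\<^sub>R (p2 k - pb)) \<longlonglongrightarrow> w"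
    using LIMSEQ_subseq_LIMSEQ[OF w_lim s2] by (simp add: comp_def t_def \<tau>2_def p2_def)
  define x2 where "x2 k = xb + t k *\<^sub>R u" for k
  have u_lim: "(\<lambda>k. (1 / t k) *\<^sub>R (x2 k - xb)) \<longlonglongrightarrow> u"
    using t by (simp add: x2_def less_imp_neq[symmetric])
  define h where "h k = ((1 / t k) *\<^sub>R (p2 k - pb), u)" for k
  have h: "h \<longlonglongrightarrow> (w, u)" unfolding h_def[abs_def] by (intro tendsto_intros w_lim2)
  have z: "(pb, xb) + t k *\<^sub>R h k = (p2 k, x2 k)" for k
    using t[of k] by (simp add: h_def x2_def)
  define q where "q k = (1 / (t k)\<^sup>2) *\<^sub>R (g (p2 k, x2 k) - g (pb, xb) - t k *\<^sub>R G (pb, xb) (h k))" for k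
  have q: "q \<longlonglongrightarrow> (1/2) *\<^sub>R G2 (w, u) (w, u)"
    using second_order_quotient_tendsto[OF S g_deriv G_deriv t t0 h] unfolding q_def[abs_def] z .
  \<comment> \<open>The residual differs from the linearised one by the second-order term and by the
    effect of replacing \<open>h k\<close> with \<open>(w, u)\<close>; both vanish after division by
    \<open>t k\<close>.\<close>
  have d: "(\<lambda>k. infdist (g (p2 k, x2 k)) (C1 \<times> C2) / t k) \<longlonglongrightarrow> 0"
  proof (rule Lim_null_comparison[OF always_eventually])
    let ?lin = "\<lambda>k. g (pb, xb) + t k *\<^sub>R G (pb, xb) (w, u)"
    show "\<forall>k. norm (infdist (g (p2 k, x2 k)) (C1 \<times> C2) / t k)
        \<le> infdist (?lin k) (C1 \<times> C2) / t k + norm (t k *\<^sub>R q k + (G (pb, xb) (h k) - G (pb, xb) (w, u)))"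
    proof
      fix k
      have "g (p2 k, x2 k) - ?lin k = t k *\<^sub>R (t k *\<^sub>R q k + (G (pb, xb) (h k) - G (pb, xb) (w, u)))"
        using t[of k] by (simp add: q_def power2_eq_square algebra_simps)
      then have "dist (g (p2 k, x2 k)) (?lin k)
          = t k * norm (t k *\<^sub>R q k + (G (pb, xb) (h k) - G (pb, xb) (w, u)))"
        using t[of k] by (simp add: dist_norm)
      then have "infdist (g (p2 k, x2 k)) (C1 \<times> C2) \<le> infdist (?lin k) (C1 \<times> C2)
          + t k * norm (t k *\<^sub>R q k + (G (pb, xb) (h k) - G (pb, xb) (w, u)))"
        using infdist_triangle[of "g (p2 k, x2 k)" "C1 \<times> C2" "?lin k"] by simp
      then show "norm (infdist (g (p2 k, x2 k)) (C1 \<times> C2) / t k)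
        \<le> infdist (?lin k) (C1 \<times> C2) / t k + norm (t k *\<^sub>R q k + (G (pb, xb) (h k) - G (pb, xb) (w, u)))"
        using t[of k] infdist_nonneg[of "g (p2 k, x2 k)" "C1 \<times> C2"] by (simp add: field_simps)
    qed
    have "(\<lambda>k. infdist (?lin k) (C1 \<times> C2) / t k + norm (t k *\<^sub>R q k + (G (pb, xb) (h k) - G (pb, xb) (w, u))))
        \<longlonglongrightarrow> 0 + norm (0 *\<^sub>R ((1/2) *\<^sub>R G2 (w, u) (w, u)) + (G (pb, xb) (w, u) - G (pb, xb) (w, u)))"
      by (intro tendsto_intros lin t0 q h)
    then show "(\<lambda>k. infdist (?lin k) (C1 \<times> C2) / t k + norm (t k *\<^sub>R q k + (G (pb, xb) (h k) - G (pb, xb) (w, u))))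
        \<longlonglongrightarrow> 0" by simp
  qed
  \<comment> \<open>Applied with radius \<open>t\<close> and \<open>B = 1\<close>; the direction is
    nonzero because \<open>w\<close> is a unit vector.\<close>
  have "\<forall>\<^sub>F k in sequentially. \<exists>\<xi>. dist \<xi> (x2 k) < t k \<and> g (p2 k, \<xi>) \<in> C1 \<times> C2"
    using w by (intro eventually_feasible_nearby[OF t t0 p2P w_lim2 u_lim _ t _ d, of 1]) auto
  then obtain N2 where N2: "\<And>k. k \<ge> N2 \<Longrightarrow> \<exists>\<xi>. dist \<xi> (x2 k) < t k \<and> g (p2 k, \<xi>) \<in> C1 \<times> C2"
    unfolding eventually_sequentially by blast
  \<comment> \<open>\<open>k + N2\<close> passes the threshold of feasibility, and
    \<open>Suc N\<close> accounts for the shift in \<open>p1\<close>.\<close>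
  define \<sigma> where "\<sigma> k = s1 (s2 (k + N2)) + Suc N" for k
  have "strict_mono \<sigma>"
    using s1 s2 by (simp add: \<sigma>_def strict_mono_def)
  \<comment> \<open>In the constant, \<open>norm u\<close> comes from the offset of
    \<open>x2\<close> from \<open>xb\<close>, and 2 from the steps between \<open>\<xi>\<close> and
    \<open>x2\<close> and between \<open>xb\<close> and \<open>x\<close>.\<close>
  moreover have "\<exists>\<xi>. g (p (\<sigma> k), \<xi>) \<in> C1 \<times> C2 \<and>
      dist \<xi> (x (\<sigma> k)) \<le> (2 + norm u) * norm (p (\<sigma> k) - pb, x (\<sigma> k) - xb)" for k
  proof -
    define n where "n = norm (p (\<sigma> k) - pb, x (\<sigma> k) - xb)"
    have p2: "p2 (k + N2) = p (\<sigma> k)" by (simp add: p2_def p1_def \<sigma>_def)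
    obtain \<xi> where \<xi>: "dist \<xi> (x2 (k + N2)) < t (k + N2)" "g (p (\<sigma> k), \<xi>) \<in> C1 \<times> C2"
      using N2[of "k + N2"] p2 by auto
    have tn: "t (k + N2) \<le> n" unfolding t_eq p2 n_def by (rule norm_fst_le)
    have xn: "dist xb (x (\<sigma> k)) \<le> n"
      using norm_snd_le[of "x (\<sigma> k) - xb" "p (\<sigma> k) - pb"] unfolding n_def
      by (simp add: dist_norm norm_minus_commute)
    have "dist (x2 (k + N2)) xb = t (k + N2) * norm u"
      using t[of "k + N2"] by (simp add: x2_def dist_norm)
    also have "\<dots> \<le> n * norm u" using tn by (rule mult_right_mono) simp
    finally have "dist \<xi> (x (\<sigma> k)) \<le> n * norm u + 2 * n"
      using \<xi>(1) tn xn dist_triangle[of \<xi> "x (\<sigma> k)" "x2 (k + N2)"]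
        dist_triangle[of "x2 (k + N2)" "x (\<sigma> k)" xb] by linarith
    also have "\<dots> = (2 + norm u) * n" by (simp add: algebra_simps)
    finally show ?thesis using \<xi>(2) unfolding n_def by (intro exI[of _ \<xi>] conjI)
  qed
  ultimately show ?thesis by blast
qed

section \<open>Robinson stability of the whole system\<close>

text \<open>Instability gives points whose distance to the solution set exceeds the residual by an
  unbounded factor. \<open>feasible_at_linear_distance\<close> makes this distance at most
  proportional to \<open>s\<close>, so \<open>eventually_feasible_nearby\<close> with the distance
  as radius finds a solution strictly closer than the distance.\<close>

lemma robinson_stable_whole_system:
  assumes directional: "\<And>w \<tau>. w \<in> tangent_cone P pb \<Longrightarrow> (\<And>k::nat. \<tau> k > 0) \<Longrightarrow> \<tau> \<longlonglongrightarrow> 0 \<Longrightarrow>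
      \<exists>u. liminf (\<lambda>k. ereal (infdist (g (pb, xb) + \<tau> k *\<^sub>R G (pb, xb) (w, u)) (C1 \<times> C2) / \<tau> k)) = 0"
  shows "robinson_stable P (\<lambda>p x. g (p, x)) (C1 \<times> C2) pb xb"
proof (rule ccontr)
  assume unstable: "\<not> ?thesis"
  define \<Gamma> where "\<Gamma> p = {\<xi>. g (p, \<xi>) \<in> C1 \<times> C2}" for p
  define D where "D p x = infdist (g (p, x)) (C1 \<times> C2)" for p x
  \<comment> \<open>Stability also demands a nonempty solution set, so its failure gives the strict
    inequality only under \<open>\<Gamma> p \<noteq> {}\<close>. Nonemptiness is recovered along a
    subsequence from \<open>close\<close>.\<close>
  have "\<exists>p x. p \<in> P \<and> dist p pb < inverse (real (Suc k)) \<and> dist x xb < inverse (real (Suc k)) \<and>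
      (\<Gamma> p \<noteq> {} \<longrightarrow> real (Suc k) * D p x < infdist x (\<Gamma> p))" for k
  proof (rule ccontr)
    assume *: "\<not> ?thesis"
    have "robinson_stable P (\<lambda>p x. g (p, x)) (C1 \<times> C2) pb xb"
      unfolding robinson_stable_def
    proof (rule exI[of _ "real (Suc k)"], rule conjI, simp,
        rule exI[of _ "ball xb (inverse (real (Suc k)))"],
        rule exI[of _ "ball pb (inverse (real (Suc k)))"], intro conjI ballI)
      fix p x assume "p \<in> P \<inter> ball pb (inverse (real (Suc k)))" "x \<in> ball xb (inverse (real (Suc k)))"
      then have "p \<in> P" "dist p pb < inverse (real (Suc k))" "dist x xb < inverse (real (Suc k))"
        by (simp_all add: dist_commute)
      then have "\<Gamma> p \<noteq> {} \<and> infdist x (\<Gamma> p) \<le> real (Suc k) * D p x"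
        using * not_less by blast
      then show "{\<xi>. g (p, \<xi>) \<in> C1 \<times> C2} \<noteq> {}"
        "infdist x {\<xi>. g (p, \<xi>) \<in> C1 \<times> C2} \<le> real (Suc k) * infdist (g (p, x)) (C1 \<times> C2)"
        by (auto simp: \<Gamma>_def D_def)
    qed auto
    with unstable show False by blast
  qed
  then obtain p x where pP: "\<And>k. p k \<in> P"
    and near: "\<And>k. dist (p k) pb < inverse (real (Suc k))" "\<And>k. dist (x k) xb < inverse (real (Suc k))"
    and bad: "\<And>k. \<Gamma> (p k) \<noteq> {} \<Longrightarrow> real (Suc k) * D (p k) (x k) < infdist (x k) (\<Gamma> (p k))"
    by metis
  have p: "p \<longlonglongrightarrow> pb" and x: "x \<longlonglongrightarrow> xb"
    using near by (auto intro!: metric_tendsto_imp_tendsto[OF LIMSEQ_inverse_real_of_nat]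
        always_eventually less_imp_le simp: dist_real_def)
  define s where "s k = norm (p k - pb, x k - xb)" for k
  \<comment> \<open>A solution \<open>x k\<close> would have distance 0, against the strict
    inequality. As \<open>xb\<close> solves the system at \<open>pb\<close>, this makes
    \<open>s k\<close> positive.\<close>
  have "x k \<notin> \<Gamma> (p k)" for k
  proof
    assume "x k \<in> \<Gamma> (p k)"
    moreover from this have "D (p k) (x k) = 0" by (simp add: \<Gamma>_def D_def)
    ultimately show False using bad[of k] by auto
  qed
  moreover have "xb \<in> \<Gamma> pb" using feas by (simp add: \<Gamma>_def)
  ultimately have "(p k, x k) \<noteq> (pb, xb)" for k by (metis Pair_inject)
  then have s: "s k > 0" for k unfolding s_def by (simp add: zero_prod_def)
  have s0: "s \<longlonglongrightarrow> 0"
  proof -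
    have "(\<lambda>k. norm (p k - pb, x k - xb)) \<longlonglongrightarrow> norm (pb - pb, xb - xb)"
      by (intro tendsto_intros p x)
    then show ?thesis by (simp add: s_def[abs_def])
  qed
  have "\<forall>k. (1 / s k) *\<^sub>R (p k - pb, x k - xb) \<in> sphere 0 1"
    using s by (simp add: s_def del: scaleR_Pair)
  from seq_compactE[OF compact_imp_seq_compact[OF compact_sphere] this]
  obtain wu s1 where wu: "wu \<in> sphere 0 1" and s1: "strict_mono (s1 :: nat \<Rightarrow> nat)"
    and wu_lim: "((\<lambda>k. (1 / s k) *\<^sub>R (p k - pb, x k - xb)) \<circ> s1) \<longlonglongrightarrow> wu"
    by blast
  obtain w u where wu_eq: "wu = (w, u)" by (cases wu)
  \<comment> \<open>Applied along \<open>s1\<close>, so that the limit direction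
    \<open>(w, u)\<close> persists on the further subsequence \<open>s2\<close>.\<close>
  obtain s2 B where s2: "strict_mono (s2 :: nat \<Rightarrow> nat)" and close:
    "\<And>k. \<exists>\<xi>. g (p (s1 (s2 k)), \<xi>) \<in> C1 \<times> C2 \<and> dist \<xi> (x (s1 (s2 k))) \<le> B * s (s1 (s2 k))"
    using feasible_at_linear_distance[of "p \<circ> s1" "x \<circ> s1", OF _ LIMSEQ_subseq_LIMSEQ[OF p s1]
        LIMSEQ_subseq_LIMSEQ[OF x s1] directional] pP
    unfolding comp_def s_def by metis
  define \<sigma> where "\<sigma> = s1 \<circ> s2"
  have \<sigma>: "strict_mono \<sigma>" unfolding \<sigma>_def using s1 s2 by (rule strict_mono_o)
  define r where "r k = infdist (x (\<sigma> k)) (\<Gamma> (p (\<sigma> k)))" for k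
  have close': "\<exists>\<xi>\<in>\<Gamma> (p (\<sigma> k)). dist (x (\<sigma> k)) \<xi> \<le> B * s (\<sigma> k)" for k
    using close[of k] by (simp add: Bex_def \<Gamma>_def \<sigma>_def dist_commute)
  then have ne_\<Gamma>: "\<Gamma> (p (\<sigma> k)) \<noteq> {}" for k by blast
  have rD: "real (Suc (\<sigma> k)) * D (p (\<sigma> k)) (x (\<sigma> k)) < r k" for k
    unfolding r_def by (rule bad[OF ne_\<Gamma>])
  have D0: "D (p (\<sigma> k)) (x (\<sigma> k)) \<ge> 0" for k by (simp add: D_def infdist_nonneg)
  have r: "r k > 0" for k
    using rD[of k] D0[of k] by (meson le_less_trans mult_nonneg_nonneg of_nat_0_le_iff)
  have rB: "r k \<le> B * s (\<sigma> k)" for k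
    using close'[of k] unfolding r_def by (blast intro: infdist_le2)
  have "(\<lambda>k. (1 / s (\<sigma> k)) *\<^sub>R (p (\<sigma> k) - pb, x (\<sigma> k) - xb)) \<longlonglongrightarrow> (w, u)"
    using LIMSEQ_subseq_LIMSEQ[OF wu_lim s2] by (simp add: comp_def \<sigma>_def wu_eq)
  from tendsto_fst[OF this] tendsto_snd[OF this]
  have w_lim: "(\<lambda>k. (1 / s (\<sigma> k)) *\<^sub>R (p (\<sigma> k) - pb)) \<longlonglongrightarrow> w"
    and u_lim: "(\<lambda>k. (1 / s (\<sigma> k)) *\<^sub>R (x (\<sigma> k) - xb)) \<longlonglongrightarrow> u" by simp_all
  have nz: "(w, u) \<noteq> (0, 0)" using wu by (auto simp: wu_eq simp flip: zero_prod_def)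
  \<comment> \<open>The quotient is below \<open>1 / Suc (\<sigma> k)\<close>, and
    \<open>\<sigma> k \<ge> k\<close>.\<close>
  have d: "(\<lambda>k. infdist (g (p (\<sigma> k), x (\<sigma> k))) (C1 \<times> C2) / r k) \<longlonglongrightarrow> 0"
  proof (rule Lim_null_comparison[OF always_eventually LIMSEQ_inverse_real_of_nat], rule allI)
    fix k
    have "real (Suc k) * D (p (\<sigma> k)) (x (\<sigma> k)) \<le> real (Suc (\<sigma> k)) * D (p (\<sigma> k)) (x (\<sigma> k))"
      using strict_mono_imp_increasing[OF \<sigma>, of k] D0[of k] by (intro mult_right_mono) auto
    then have "real (Suc k) * D (p (\<sigma> k)) (x (\<sigma> k)) \<le> r k" using rD[of k] by linarith
    then show "norm (infdist (g (p (\<sigma> k), x (\<sigma> k))) (C1 \<times> C2) / r k) \<le> inverse (real (Suc k))"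
      using r[of k] D0[of k] by (simp add: D_def[symmetric] field_simps)
  qed
  have "\<forall>\<^sub>F k in sequentially. \<exists>\<xi>. dist \<xi> (x (\<sigma> k)) < r k \<and> g (p (\<sigma> k), \<xi>) \<in> C1 \<times> C2"
    using s LIMSEQ_subseq_LIMSEQ[OF s0 \<sigma>] pP
    by (intro eventually_feasible_nearby[OF _ _ _ w_lim u_lim nz r rB d]) (simp_all add: comp_def)
  then have "\<exists>k. \<exists>\<xi>\<in>\<Gamma> (p (\<sigma> k)). dist (x (\<sigma> k)) \<xi> < r k"
    using eventually_happens'[OF sequentially_bot] by (fastforce simp: \<Gamma>_def dist_commute simp del: mem_Sigma_iff)
  then show False
    unfolding r_def using infdist_le by (metis not_less)
qed

end

section \<open>Transfer from the locale to the stated hypotheses\<close>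

theorem theorem4p3:
  fixes P :: "'m::euclidean_space set" and pb :: 'm and xb :: "'n::euclidean_space"
    and g :: "'m \<times> 'n \<Rightarrow> 'a::euclidean_space \<times> 'b::euclidean_space"
    and C1 :: "'a set" and C2 :: "'b set"
    and G :: "'m \<times> 'n \<Rightarrow> ('m \<times> 'n) \<Rightarrow>\<^sub>L ('a \<times> 'b)"
    and G2 :: "'m \<times> 'n \<Rightarrow> ('m \<times> 'n) \<Rightarrow>\<^sub>L ('a \<times> 'b)"
  assumes closed1: "closed C1" and closed2: "closed C2"
    and pbP: "pb \<in> P"
    and feas: "g (pb, xb) \<in> C1 \<times> C2"
    \<comment> \<open>g twice differentiable at (pb,xb): first derivative G near (pb,xb), which is differentiable at (pb,xb)\<close>
    and twice_diff: "\<exists>S. open S \<and> (pb, xb) \<in> S \<and> (\<forall>z\<in>S. (g has_derivative blinfun_apply (G z)) (at z))"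
    and G_deriv: "(G has_derivative G2) (at (pb, xb))"
    \<comment> \<open>standing assumptions\<close>
    and standing: "\<exists>U V. open U \<and> xb \<in> U \<and> open V \<and> pb \<in> V \<and>
        (\<forall>p\<in>P \<inter> V. \<exists>Gx :: 'n \<Rightarrow> 'n \<Rightarrow>\<^sub>L ('a \<times> 'b).
            (\<forall>x\<in>U. ((\<lambda>x. g (p, x)) has_derivative blinfun_apply (Gx x)) (at x)) \<and> continuous_on U Gx)"
    and g_cont: "isCont g (pb, xb)"
    and gx_cont: "isCont (\<lambda>z. blinfun_apply (G z) \<circ> (\<lambda>u. (0, u))) (pb, xb)"
    \<comment> \<open>(a)\<close>
    and cond_a: "\<forall>w\<in>tangent_cone P pb. \<forall>\<tau>::nat \<Rightarrow> real. (\<forall>k. \<tau> k > 0) \<and> \<tau> \<longlonglongrightarrow> 0 \<longrightarrow>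
        (\<exists>u::'n. liminf (\<lambda>k. ereal (infdist (g (pb, xb) + \<tau> k *\<^sub>R blinfun_apply (G (pb, xb)) (w, u)) (C1 \<times> C2) / \<tau> k)) = 0)"
    \<comment> \<open>(b)\<close>
    and cond_b: "robinson_stable P (\<lambda>p x. snd (g (p, x))) C2 pb xb"
    \<comment> \<open>(c)\<close>
    and cond_c: "\<forall>w u lam. (w, u) \<noteq> (0, 0) \<and> w \<in> tangent_cone P pb \<and>
        blinfun_apply (G (pb, xb)) (w, u) \<in> tangent_cone (C1 \<times> C2) (g (pb, xb)) \<and>
        lam \<in> dir_limiting_normal_cone (C1 \<times> C2) (g (pb, xb)) (blinfun_apply (G (pb, xb)) (w, u)) \<and>
        (\<forall>u'. inner lam (blinfun_apply (G (pb, xb)) (0, u')) = 0) \<and>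
        ereal (inner lam (blinfun_apply (G2 (w, u)) (w, u)) / 2)
          + upper_curvature P (adjoint (\<lambda>w'. blinfun_apply (G (pb, xb)) (w', 0)) lam) pb w
          \<ge> lower_curvature (C1 \<times> C2) lam (g (pb, xb)) (blinfun_apply (G (pb, xb)) (w, u))
        \<longrightarrow> fst lam = 0"
  shows "robinson_stable P (\<lambda>p x. g (p, x)) (C1 \<times> C2) pb xb"
proof -
  obtain S where S: "open S" "(pb, xb) \<in> S" "\<And>z. z \<in> S \<Longrightarrow> (g has_derivative blinfun_apply (G z)) (at z)"
    using twice_diff by blast
  \<comment> \<open>Once the neighbourhood \<open>S\<close> is fixed, (b) and (c) become
    \<open>stable2\<close> and \<open>second_order\<close>; (a) is supplied afterwards.\<close>
  interpret split_system P pb xb g C1 C2 G G2 S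
  proof unfold_locales
    fix w u lam
    assume "(w, u) \<noteq> (0, 0)" "w \<in> tangent_cone P pb"
      "G (pb, xb) (w, u) \<in> tangent_cone (C1 \<times> C2) (g (pb, xb))"
      "lam \<in> dir_limiting_normal_cone (C1 \<times> C2) (g (pb, xb)) (G (pb, xb) (w, u))"
      "\<And>u'. inner lam (G (pb, xb) (0, u')) = 0"
      "lower_curvature (C1 \<times> C2) lam (g (pb, xb)) (G (pb, xb) (w, u))
        \<le> ereal (inner lam (G2 (w, u) (w, u)) / 2)
          + upper_curvature P (adjoint (\<lambda>w'. G (pb, xb) (w', 0)) lam) pb w"
    then show "fst lam = 0" using cond_c[rule_format, of w u lam] by blast
  qed (fact closed1 closed2 feas S G_deriv cond_b)+
  show ?thesis using cond_a by (intro robinson_stable_whole_system) blast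
qed

end
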